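(* Let $E$ be a finite transitive directed graph in which every cycle has an exit. Let $u\in\mathfrak{B}$ be a unitary such that $u\mathcal{D}_E^1u^*\neq\mathcal{D}_E^1$, and let $d\in\mathcal{D}_E^1$ be a unitary such that $udu^*\notin\mathcal{D}_E^1$. Then for all $x,y\in C^*(E)$ we have $$\lim_{k\to\infty}\bigl\|\Phi_{\mathcal{D}}\bigl(x\cdot udu^*\,\varphi(udu^* )\cdots\varphi^{k-1}(udu^* )\cdot y\bigr)\bigr\|_2=0.$$ Consequently, $\mathcal{D}_E$ and $\lambda_u(\mathcal{D}_E)$ are not inner conjugate in $C^*(E)$, i.e. there is no unitary $w\in C^*(E)$ with $w\mathcal{D}_Ew^*=\lambda_u(\mathcal{D}_E)$.
   Context: $E=(E^0,E^1,r,s)$ is a directed graph with finite vertex set $E^0$, finite edge set $E^1$, range and source maps $r,s:E^1\to E^0$. A path of length $k\ge1$ is $\mu=(\mu_1,\dots,\mu_k)$, $\mu_j\in E^1$, with $r(\mu_j)=s(\mu_{j+1})$; vertices are paths of length $0$; $E^k$ is the set of paths of length $k$, $E^*=\bigcup_k E^k$; $r,s$ extend to paths. $E$ is transitive if for any two vertices $v,w$ there is a path of non-zero length from $v$ to $w$. A cycle is a path $\mu$ of length $\geq 1$ with $s(\mu)=r(\mu)$; it has an exit if some $s(\mu_j)$ emits at least two distinct edges. The adjacency matrix is $A(v,w)=\#\{e\in E^1: s(e)=v,r(e)=w\}$. $C^*(E)$ is the universal $C^*$-algebra generated by mutually orthogonal projections $P_v$ ($v\in E^0$) and partial isometries $S_e$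 ($e\in E^1$) with $S_e^*S_e=P_{r(e)}$ and $P_v=\sum_{s(e)=v}S_eS_e^*$ (for $v$ emitting at least one edge). For a path $\mu=(\mu_1,\dots,\mu_k)$, $S_\mu=S_{\mu_1}\cdots S_{\mu_k}$, $S_v=P_v$, and $P_\mu=S_\mu S_\mu^*$. $\mathcal{D}_E^k=\mathrm{span}\{P_\mu:\mu\in E^k\}$ and the diagonal subalgebra $\mathcal{D}_E$ is the norm closure of $\bigcup_k\mathcal{D}_E^k$. $\mathcal{F}_E^k=\mathrm{span}\{S_\mu S_\nu^*:|\mu|=|\nu|=k\}$ and the core AF-subalgebra $\mathcal{F}_E$ is the norm closure of $\bigcup_k\mathcal{F}_E^k$. $\mathfrak{B}=(\mathcal{D}_E^0)'\cap\mathcal{F}_E^1$, i.e. the linear span of the elements $S_eS_f^*$, $e,f\in E^1$, with $s(e)=s(f)$. The shift is $\varphi(x)=\sum_{e\in E^1}S_exS_e^*$, $x\in C^*(E)$. $\Phi_{\mathcal{D}}:C^*(E)\to\mathcal{D}_E$ is the faithful conditional expectation with $\Phi_{\mathcal{D}}(S_\mu S_\nu^* )=0$ for $\mu\neq\nu$. For a unitary $u\in\mathfrak{B}$, $\lambda_u$ is the automorphism of $C^*(E)$ determined by $\lambda_u(S_e)=uS_e$ ($e\in E^1$) and $\lambda_u(P_v)=P_v$ ($v\in E^0$). Let $\beta>0$ be the Perron–Frobenius eigenvalue of $A$ and $(x(v))_{v\in E^0}$, $x(v)>0$, a corresponding eigenvector, $\sum_wA(v,w)x(w)=\beta x(v)$;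 $X=\sum_vx(v)$. $\tau$ is the tracial state on $\mathcal{F}_E$ with $\tau(S_\mu S_\nu^* )=\delta_{\mu,\nu}\,x(r(\mu))/(X\beta^k)$ for $\mu,\nu\in E^k$ with $r(\mu)=r(\nu)$, and $\|a\|_2=\tau(a^*a)^{1/2}$ for $a\in\mathcal{F}_E$. *)

theory Defs
  imports "HOL-Analysis.Analysis" "HOL-Algebra.Ring" "Graph_Theory.Arc_Walk"
begin

text \<open>
  The class is used for the algebra under study. The records below are needed in addition because
  a universal property quantifies over C*-algebras inside a formula.
\<close>

class cstar_algebra = real_normed_algebra_1 + banach +
  fixes scaleC :: "complex \<Rightarrow> 'a \<Rightarrow> 'a" (infixr "*\<^sub>C" 75)
    and star :: "'a \<Rightarrow> 'a"
  assumes scaleC_add_right: "c *\<^sub>C (x + y) = c *\<^sub>C x + c *\<^sub>C y"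
    and scaleC_add_left: "(b + c) *\<^sub>C x = b *\<^sub>C x + c *\<^sub>C x"
    and scaleC_scaleC: "b *\<^sub>C (c *\<^sub>C x) = (b * c) *\<^sub>C x"
    and scaleC_of_real: "complex_of_real r *\<^sub>C x = r *\<^sub>R x"
    and mult_scaleC_left: "(c *\<^sub>C x) * y = c *\<^sub>C (x * y)"
    and mult_scaleC_right: "x * (c *\<^sub>C y) = c *\<^sub>C (x * y)"
    and norm_scaleC: "norm (c *\<^sub>C x) = cmod c * norm x"
    and star_star: "star (star x) = x"
    and star_add: "star (x + y) = star x + star y"
    and star_mult: "star (x * y) = star y * star x"
    and star_scaleC: "star (c *\<^sub>C x) = cnj c *\<^sub>C star x"
    and cstar_identity: "norm (star x * x) = (norm x)\<^sup>2"

lemma vector_space_scaleC: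
  "vector_space (scaleC :: complex \<Rightarrow> 'a \<Rightarrow> 'a::cstar_algebra)"
proof
  fix x :: 'a
  show "1 *\<^sub>C x = x" using scaleC_of_real[of 1 x] by simp
qed (simp_all add: scaleC_add_right scaleC_add_left scaleC_scaleC)

global_interpretation complex_vector:
  vector_space "scaleC :: complex \<Rightarrow> 'a \<Rightarrow> 'a::cstar_algebra"
  defines cspan = "complex_vector.span"
    and csubspace = "complex_vector.subspace"
  by (rule vector_space_scaleC)

abbreviation clinear :: "('a::cstar_algebra \<Rightarrow> 'a) \<Rightarrow> bool"
  where "clinear \<equiv> Vector_Spaces.linear scaleC scaleC"

definition unitary :: "'a::cstar_algebra \<Rightarrow> bool"
  where "unitary u \<longleftrightarrow> star u * u = 1 \<and> u * star u = 1"

definition conj_by :: "'a::cstar_algebra \<Rightarrow> 'a \<Rightarrow> 'a"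
  where "conj_by w a = w * a * star w"

text \<open>Subalgebras need not contain the unit.\<close>

definition cstar_subalgebra :: "'a::cstar_algebra set \<Rightarrow> bool"
  where "cstar_subalgebra C \<longleftrightarrow>
    csubspace C \<and> closed C \<and> (\<forall>a\<in>C. star a \<in> C) \<and> (\<forall>a\<in>C. \<forall>b\<in>C. a * b \<in> C)"

record 'a cstar_struct = "'a ring" +
  cscale :: "complex \<Rightarrow> 'a \<Rightarrow> 'a"
  cstar :: "'a \<Rightarrow> 'a"
  cnorm :: "'a \<Rightarrow> real"

locale cstar_algebra_on = ring B for B :: "'a cstar_struct" (structure) +
  assumes cscale_closed: "a \<in> carrier B \<Longrightarrow> cscale B c a \<in> carrier B"
    and cscale_add_right: "\<lbrakk>a \<in> carrier B; b \<in> carrier B\<rbrakk> \<Longrightarrow>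
          cscale B c (a \<oplus> b) = cscale B c a \<oplus> cscale B c b"
    and cscale_add_left: "a \<in> carrier B \<Longrightarrow>
          cscale B (c + c') a = cscale B c a \<oplus> cscale B c' a"
    and cscale_cscale: "a \<in> carrier B \<Longrightarrow> cscale B c (cscale B c' a) = cscale B (c * c') a"
    and cscale_one: "a \<in> carrier B \<Longrightarrow> cscale B 1 a = a"
    and mult_cscale_left: "\<lbrakk>a \<in> carrier B; b \<in> carrier B\<rbrakk> \<Longrightarrow>
          cscale B c a \<otimes> b = cscale B c (a \<otimes> b)"
    and mult_cscale_right: "\<lbrakk>a \<in> carrier B; b \<in> carrier B\<rbrakk> \<Longrightarrow>
          a \<otimes> cscale B c b = cscale B c (a \<otimes> b)"
    and cstar_closed: "a \<in> carrier B \<Longrightarrow> cstar B a \<in> carrier B"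
    and cstar_cstar: "a \<in> carrier B \<Longrightarrow> cstar B (cstar B a) = a"
    and cstar_add: "\<lbrakk>a \<in> carrier B; b \<in> carrier B\<rbrakk> \<Longrightarrow>
          cstar B (a \<oplus> b) = cstar B a \<oplus> cstar B b"
    and cstar_mult: "\<lbrakk>a \<in> carrier B; b \<in> carrier B\<rbrakk> \<Longrightarrow>
          cstar B (a \<otimes> b) = cstar B b \<otimes> cstar B a"
    and cstar_cscale: "a \<in> carrier B \<Longrightarrow> cstar B (cscale B c a) = cscale B (cnj c) (cstar B a)"
    and cnorm_nonneg: "a \<in> carrier B \<Longrightarrow> 0 \<le> cnorm B a"
    and cnorm_eq_0: "a \<in> carrier B \<Longrightarrow> cnorm B a = 0 \<longleftrightarrow> a = \<zero>"
    and cnorm_triangle: "\<lbrakk>a \<in> carrier B; b \<in> carrier B\<rbrakk> \<Longrightarrow>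
          cnorm B (a \<oplus> b) \<le> cnorm B a + cnorm B b"
    and cnorm_cscale: "a \<in> carrier B \<Longrightarrow> cnorm B (cscale B c a) = cmod c * cnorm B a"
    and cnorm_mult: "\<lbrakk>a \<in> carrier B; b \<in> carrier B\<rbrakk> \<Longrightarrow>
          cnorm B (a \<otimes> b) \<le> cnorm B a * cnorm B b"
    and cnorm_cstar: "a \<in> carrier B \<Longrightarrow> cnorm B (cstar B a \<otimes> a) = (cnorm B a)\<^sup>2"
    and complete: "Metric_space.mcomplete (carrier B) (\<lambda>a b. cnorm B (a \<ominus> b))"

definition cstar_UNIV :: "'a::cstar_algebra cstar_struct"
  where "cstar_UNIV = \<lparr>carrier = UNIV, mult = (*), one = 1, zero = 0, add = (+),
    cscale = scaleC, cstar = star, cnorm = norm\<rparr>"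

lemma cstar_algebra_on_UNIV: "cstar_algebra_on (cstar_UNIV :: 'a::cstar_algebra cstar_struct)"
proof -
  let ?B = "cstar_UNIV :: 'a cstar_struct"
  have units: "\<exists>y. x + y = 0" for x :: 'a
    by (rule exI[of _ "- x"]) simp
  interpret R: ring ?B
    by (unfold_locales)
      (auto simp: cstar_UNIV_def Units_def algebra_simps units)
  have minus: "a_minus ?B a b = a - b" for a b
  proof -
    have "a_inv ?B b = - b"
      by (rule R.minus_equality) (simp_all add: cstar_UNIV_def)
    then show ?thesis by (simp add: a_minus_def cstar_UNIV_def)
  qed
  have compl: "Metric_space.mcomplete (UNIV :: 'a set) (\<lambda>a b. norm (a - b))"
  proof -
    have "Metric_space.mcomplete (UNIV :: 'a set) dist"
      using complete_UNIV by (simp add: mcomplete_iff_complete)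
    then show ?thesis by (simp add: dist_norm[abs_def])
  qed
  show ?thesis
    by (unfold_locales)
      (auto simp: minus, auto simp: cstar_UNIV_def compl scaleC_add_right scaleC_add_left
        scaleC_scaleC mult_scaleC_left mult_scaleC_right norm_scaleC star_star star_add star_mult
        star_scaleC cstar_identity norm_triangle_ineq norm_mult_ineq)
qed

definition star_hom :: "'a cstar_struct \<Rightarrow> 'b cstar_struct \<Rightarrow> ('a \<Rightarrow> 'b) set"
  where "star_hom A B = {\<pi> \<in> carrier A \<rightarrow> carrier B.
    (\<forall>a\<in>carrier A. \<forall>b\<in>carrier A. \<pi> (a \<oplus>\<^bsub>A\<^esub> b) = \<pi> a \<oplus>\<^bsub>B\<^esub> \<pi> b) \<and>
    (\<forall>a\<in>carrier A. \<forall>b\<in>carrier A. \<pi> (a \<otimes>\<^bsub>A\<^esub> b) = \<pi> a \<otimes>\<^bsub>B\<^esub> \<pi> b) \<and>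
    (\<forall>c. \<forall>a\<in>carrier A. \<pi> (cscale A c a) = cscale B c (\<pi> a)) \<and>
    (\<forall>a\<in>carrier A. \<pi> (cstar A a) = cstar B (\<pi> a))}"

definition star_automorphism :: "('a::cstar_algebra \<Rightarrow> 'a) \<Rightarrow> bool"
  where "star_automorphism f \<longleftrightarrow> f \<in> star_hom cstar_UNIV cstar_UNIV \<and> bij f"

definition faithful_conditional_expectation ::
    "('a::cstar_algebra \<Rightarrow> 'a) \<Rightarrow> 'a set \<Rightarrow> bool"
  where "faithful_conditional_expectation \<Phi> D \<longleftrightarrow>
    clinear \<Phi> \<and> range \<Phi> \<subseteq> D \<and> (\<forall>a\<in>D. \<Phi> a = a) \<and>
    (\<forall>a\<in>D. \<forall>b\<in>D. \<forall>x. \<Phi> (a * x * b) = a * \<Phi> x * b) \<and>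
    (\<forall>x. \<exists>y\<in>D. \<Phi> (star x * x) = star y * y) \<and>
    (\<forall>x. norm (\<Phi> x) \<le> norm x) \<and>
    (\<forall>x. \<Phi> (star x * x) = 0 \<longrightarrow> x = 0)"

text \<open>The values of \<open>\<tau>\<close> outside \<open>F\<close> are irrelevant.\<close>

definition tracial_state_on :: "'a::cstar_algebra set \<Rightarrow> ('a \<Rightarrow> complex) \<Rightarrow> bool"
  where "tracial_state_on F \<tau> \<longleftrightarrow>
    (\<forall>a\<in>F. \<forall>b\<in>F. \<tau> (a + b) = \<tau> a + \<tau> b) \<and>
    (\<forall>c. \<forall>a\<in>F. \<tau> (c *\<^sub>C a) = c * \<tau> a) \<and>
    (\<forall>a\<in>F. \<tau> (star a * a) \<in> \<real>\<^sub>\<ge>\<^sub>0) \<and>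
    (\<forall>a\<in>F. cmod (\<tau> a) \<le> norm a) \<and> \<tau> 1 = 1 \<and>
    (\<forall>a\<in>F. \<forall>b\<in>F. \<tau> (a * b) = \<tau> (b * a))"

definition norm2 :: "('a::cstar_algebra \<Rightarrow> complex) \<Rightarrow> 'a \<Rightarrow> real"
  where "norm2 \<tau> a = sqrt (Re (\<tau> (star a * a)))"

text \<open>
  The source and range of an edge are its tail and head. A path is a pair of its source and the
  list of its edges: this makes vertices paths of length 0, and for positive length the first
  component is determined by the second.
\<close>

definition paths :: "('v, 'e) pre_digraph \<Rightarrow> nat \<Rightarrow> ('v \<times> 'e list) set"
  where "paths E k = {(v, p). length p = k \<and> (\<exists>w. pre_digraph.awalk E v p w)}"

definition path_range :: "('v, 'e) pre_digraph \<Rightarrow> 'v \<times> 'e list \<Rightarrow> 'v"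
  where "path_range E \<mu> = last (pre_digraph.awalk_verts E (fst \<mu>) (snd \<mu>))"

definition transitive_graph :: "('v, 'e) pre_digraph \<Rightarrow> bool"
  where "transitive_graph E \<longleftrightarrow>
    (\<forall>v\<in>verts E. \<forall>w\<in>verts E. \<exists>p. p \<noteq> [] \<and> pre_digraph.awalk E v p w)"

text \<open>Unlike \<^const>\<open>pre_digraph.cycle\<close>, a cycle may revisit vertices here.\<close>

definition every_cycle_has_exit :: "('v, 'e) pre_digraph \<Rightarrow> bool"
  where "every_cycle_has_exit E \<longleftrightarrow>
    (\<forall>v p. p \<noteq> [] \<and> pre_digraph.awalk E v p v \<longrightarrow>
      (\<exists>e\<in>set p. \<exists>f\<in>out_arcs E (tail E e). \<exists>g\<in>out_arcs E (tail E e). f \<noteq> g))"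

definition adjacency :: "('v, 'e) pre_digraph \<Rightarrow> 'v \<Rightarrow> 'v \<Rightarrow> nat"
  where "adjacency E v w = card {e \<in> arcs E. tail E e = v \<and> head E e = w}"

definition adjacency_eigenvector ::
    "('v, 'e) pre_digraph \<Rightarrow> 'k::field \<Rightarrow> ('v \<Rightarrow> 'k) \<Rightarrow> bool"
  where "adjacency_eigenvector E z y \<longleftrightarrow>
    (\<exists>v\<in>verts E. y v \<noteq> 0) \<and>
    (\<forall>v\<in>verts E. (\<Sum>w\<in>verts E. of_nat (adjacency E v w) * y w) = z * y v)"

definition perron_frobenius_eigenvalue :: "('v, 'e) pre_digraph \<Rightarrow> real \<Rightarrow> bool"
  where "perron_frobenius_eigenvalue E \<beta> \<longleftrightarrow>
    (\<exists>y :: 'v \<Rightarrow> real. adjacency_eigenvector E \<beta> y) \<and>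
    (\<forall>(z::complex) y. adjacency_eigenvector E z y \<longrightarrow> cmod z \<le> \<beta>)"

definition ck_family ::
    "('v, 'e) pre_digraph \<Rightarrow> 'a cstar_struct \<Rightarrow> ('v \<Rightarrow> 'a) \<Rightarrow> ('e \<Rightarrow> 'a) \<Rightarrow> bool"
  where "ck_family E B P S \<longleftrightarrow>
    (\<forall>v\<in>verts E. P v \<in> carrier B \<and> P v \<otimes>\<^bsub>B\<^esub> P v = P v \<and> cstar B (P v) = P v) \<and>
    (\<forall>v\<in>verts E. \<forall>w\<in>verts E. v \<noteq> w \<longrightarrow> P v \<otimes>\<^bsub>B\<^esub> P w = \<zero>\<^bsub>B\<^esub>) \<and>
    (\<forall>e\<in>arcs E. S e \<in> carrier B \<and> S e \<otimes>\<^bsub>B\<^esub> cstar B (S e) \<otimes>\<^bsub>B\<^esub> S e = S e) \<and>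
    (\<forall>e\<in>arcs E. cstar B (S e) \<otimes>\<^bsub>B\<^esub> S e = P (head E e)) \<and>
    (\<forall>v\<in>verts E. out_arcs E v \<noteq> {} \<longrightarrow>
      P v = (\<Oplus>\<^bsub>B\<^esub>e\<in>out_arcs E v. S e \<otimes>\<^bsub>B\<^esub> cstar B (S e)))"

text \<open>
  The algebra \<open>'a\<close>, with \<open>P\<close> and \<open>S\<close>, is \<open>C*(E)\<close>. The test algebras \<open>B\<close> live on arbitrary
  subsets of \<open>'a\<close>, with operations unrelated to those of \<open>'a\<close>. For a finite graph \<open>E\<close> this is the
  universal property against all C*-algebras: a Cuntz-Krieger family takes its values in a
  separable C*-subalgebra, which has at most continuum many elements, and the nonzero complex vector
  space \<open>'a\<close> is at least that large, so that there is a copy with carrier in \<open>'a\<close>. Requiring \<open>B\<close> to be unital is no restriction either (pass to the unitization); neither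
  families nor homomorphisms have to respect the unit of \<open>B\<close>. Uniqueness of \<open>\<pi>\<close> follows from
  generation.
\<close>

definition graph_cstar_algebra ::
    "('v, 'e) pre_digraph \<Rightarrow> ('v \<Rightarrow> 'a::cstar_algebra) \<Rightarrow> ('e \<Rightarrow> 'a) \<Rightarrow> bool"
  where "graph_cstar_algebra E P S \<longleftrightarrow>
    ck_family E cstar_UNIV P S \<and>
    cstar_subalgebra hull (P ` verts E \<union> S ` arcs E) = UNIV \<and>
    (\<forall>(B :: 'a cstar_struct) Q T. cstar_algebra_on B \<and> ck_family E B Q T \<longrightarrow>
      (\<exists>\<pi>\<in>star_hom cstar_UNIV B.
        (\<forall>v\<in>verts E. \<pi> (P v) = Q v) \<and> (\<forall>e\<in>arcs E. \<pi> (S e) = T e)))"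

definition path_elem ::
    "('v \<Rightarrow> 'a::cstar_algebra) \<Rightarrow> ('e \<Rightarrow> 'a) \<Rightarrow> 'v \<times> 'e list \<Rightarrow> 'a"
  where "path_elem P S \<mu> = (if snd \<mu> = [] then P (fst \<mu>) else prod_list (map S (snd \<mu>)))"

definition diag_level ::
    "('v, 'e) pre_digraph \<Rightarrow> ('v \<Rightarrow> 'a::cstar_algebra) \<Rightarrow> ('e \<Rightarrow> 'a) \<Rightarrow> nat \<Rightarrow> 'a set"
  where "diag_level E P S k = cspan {path_elem P S \<mu> * star (path_elem P S \<mu>) | \<mu>. \<mu> \<in> paths E k}"

definition diag ::
    "('v, 'e) pre_digraph \<Rightarrow> ('v \<Rightarrow> 'a::cstar_algebra) \<Rightarrow> ('e \<Rightarrow> 'a) \<Rightarrow> 'a set"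
  where "diag E P S = closure (\<Union>k. diag_level E P S k)"

definition core_level ::
    "('v, 'e) pre_digraph \<Rightarrow> ('v \<Rightarrow> 'a::cstar_algebra) \<Rightarrow> ('e \<Rightarrow> 'a) \<Rightarrow> nat \<Rightarrow> 'a set"
  where "core_level E P S k =
    cspan {path_elem P S \<mu> * star (path_elem P S \<nu>) | \<mu> \<nu>. \<mu> \<in> paths E k \<and> \<nu> \<in> paths E k}"

definition core ::
    "('v, 'e) pre_digraph \<Rightarrow> ('v \<Rightarrow> 'a::cstar_algebra) \<Rightarrow> ('e \<Rightarrow> 'a) \<Rightarrow> 'a set"
  where "core E P S = closure (\<Union>k. core_level E P S k)"

definition frakB ::
    "('v, 'e) pre_digraph \<Rightarrow> ('v \<Rightarrow> 'a::cstar_algebra) \<Rightarrow> ('e \<Rightarrow> 'a) \<Rightarrow> 'a set"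
  where "frakB E P S = {b. \<forall>a\<in>diag_level E P S 0. a * b = b * a} \<inter> core_level E P S 1"

definition shift ::
    "('v, 'e) pre_digraph \<Rightarrow> ('e \<Rightarrow> 'a::cstar_algebra) \<Rightarrow> 'a \<Rightarrow> 'a"
  where "shift E S a = (\<Sum>e\<in>arcs E. S e * a * star (S e))"

definition shift_prod ::
    "('v, 'e) pre_digraph \<Rightarrow> ('e \<Rightarrow> 'a::cstar_algebra) \<Rightarrow> 'a \<Rightarrow> nat \<Rightarrow> 'a"
  where "shift_prod E S a k = prod_list (map (\<lambda>j. (shift E S ^^ j) a) [0..<k])"

end

theory Submission
  imports Defs
begin

text \<open>
  Put \<open>q = u d u\<^sup>*\<close> and \<open>Q\<^sub>n = q \<phi>(q) \<dots> \<phi>\<^sup>n\<^sup>-\<^sup>1(q)\<close>. Since \<open>q\<close> lies in the span of the \<open>S\<^sub>e S\<^sub>f\<^sup>*\<close>, it is a unitary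
  matrix \<open>(c\<^sub>e\<^sub>f)\<close> and \<open>Q\<^sub>n\<close> behaves like its \<open>n\<close>-fold tensor power: \<open>S\<^sub>e\<^sup>* Q\<^sub>n\<^sub>+\<^sub>1 S\<^sub>f = c\<^sub>e\<^sub>f P Q\<^sub>n\<close>. By density
  and this identity the limit reduces to the elements \<open>S\<^sub>\<mu> Q\<^sub>n S\<^sub>\<nu>\<^sup>*\<close>. The expectation kills them if
  \<open>\<mu> \<noteq> \<nu>\<close>, and for \<open>\<mu> = \<nu>\<close> the squared 2-norm of the expectation is, up to a constant factor, the
  sum of \<open>\<xi>(r(\<alpha>)) / \<beta>\<^sup>n\<close> over paths \<open>\<alpha>\<close> of length \<open>n\<close> starting at \<open>r(\<mu>)\<close>, weighted by the product
  of the \<open>\<bar>c\<^sub>e\<^sub>e\<bar>\<^sup>2\<close> over the edges \<open>e\<close> of \<open>\<alpha>\<close>. As \<open>q\<close> is not diagonal, some \<open>\<bar>c\<^sub>e\<^sub>e\<bar> < 1\<close>, and transitivity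
  forces these sums to 0.

  For the second claim, \<open>Q\<^sub>n\<close> is the image under \<open>\<Lambda>\<close> of the diagonal unitary
  \<open>d \<phi>(d) \<dots> \<phi>\<^sup>n\<^sup>-\<^sup>1(d)\<close>. If \<open>w\<close> conjugated the diagonal to its image, \<open>w\<^sup>* Q\<^sub>n w\<close> would be a diagonal
  unitary, of 2-norm 1 for all \<open>n\<close>.
\<close>

section \<open>Projections in C*-algebras\<close>

lemmas scaleC_simps = complex_vector.scale_zero_left complex_vector.scale_zero_right
  complex_vector.scale_one complex_vector.scale_minus_left complex_vector.scale_minus_right

section \<open>Elementary facts on the involution, the norm and unitaries\<close>

lemma star_zero [simp]: "star (0::'a::cstar_algebra) = 0"
  using star_add[of 0 "0::'a"] by simp

lemma star_minus: "star (- x) = - star (x::'a::cstar_algebra)"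
  using star_add[of x "- x"] by (simp add: minus_unique)

lemma star_diff: "star (x - y) = star x - star (y::'a::cstar_algebra)"
  using star_add[of x "- y"] by (simp add: star_minus)

lemma star_sum: "star (sum f A) = (\<Sum>x\<in>A. star (f x :: 'a::cstar_algebra))"
  by (induction A rule: infinite_finite_induct) (auto simp: star_add)

lemma star_one [simp]: "star (1::'a::cstar_algebra) = 1"
  by (metis mult_1 mult.right_neutral star_mult star_star)

text \<open>The C*-identity and submultiplicativity bound \<open>norm y\<close> by
  \<open>norm (star y)\<close>; applying this to \<open>star x\<close> as well gives
  equality.\<close>

lemma norm_star [simp]: "norm (star x) = norm (x::'a::cstar_algebra)"
proof -
  have le: "norm y \<le> norm (star y)" for y :: 'a
  proof (cases "y = 0")
    case False
    have "norm y * norm y \<le> norm (star y) * norm y"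
      using norm_mult_ineq[of "star y" y] by (simp add: cstar_identity power2_eq_square)
    then show ?thesis using False by simp
  qed simp
  from le[of x] le[of "star x"] show ?thesis by (simp add: star_star)
qed

lemma bounded_linear_star: "bounded_linear (star :: 'a::cstar_algebra \<Rightarrow> 'a)"
proof
  fix r :: real and x y :: 'a
  show "star (x + y) = star x + star y" by (rule star_add)
  show "star (r *\<^sub>R x) = r *\<^sub>R star x"
    by (simp flip: scaleC_of_real add: star_scaleC)
  show "\<exists>K. \<forall>x :: 'a. norm (star x) \<le> norm x * K" by (rule exI[of _ 1]) simp
qed

lemma bounded_linear_scaleC: "bounded_linear (scaleC c :: 'a::cstar_algebra \<Rightarrow> 'a)"
proof
  fix r :: real and x y :: 'a
  show "c *\<^sub>C (x + y) = c *\<^sub>C x + c *\<^sub>C y" by (rule scaleC_add_right)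
  show "c *\<^sub>C (r *\<^sub>R x) = r *\<^sub>R (c *\<^sub>C x)"
    by (simp flip: scaleC_of_real add: scaleC_scaleC mult.commute)
  show "\<exists>K. \<forall>x :: 'a. norm (c *\<^sub>C x) \<le> norm x * K"
    by (rule exI[of _ "cmod c"]) (simp add: norm_scaleC)
qed

lemmas tendsto_star = bounded_linear.tendsto[OF bounded_linear_star]
lemmas tendsto_scaleC = bounded_linear.tendsto[OF bounded_linear_scaleC]

lemma norm_unitary: "unitary (u::'a::cstar_algebra) \<Longrightarrow> norm u = 1"
  using cstar_identity[of u] norm_ge_zero[of u]
  by (auto simp: unitary_def power2_eq_1_iff simp del: norm_ge_zero)

lemma unitary_mult:
  assumes "unitary (u::'a::cstar_algebra)" and "unitary v"
  shows "unitary (u * v)"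
proof -
  have "star v * star u * (u * v) = star v * (star u * u) * v"
    and "u * v * (star v * star u) = u * (v * star v) * star u"
    by (simp_all only: mult.assoc)
  with assms show ?thesis by (simp add: unitary_def star_mult)
qed

lemma unitary_star: "unitary (u::'a::cstar_algebra) \<Longrightarrow> unitary (star u)"
  by (simp add: unitary_def star_star)

section \<open>Projections whose sum is a projection are mutually orthogonal\<close>

definition projection :: "'a::cstar_algebra \<Rightarrow> bool"
  where "projection p \<longleftrightarrow> p * p = p \<and> star p = p"

lemma norm_mult_mult_le: "norm (a * b * c) \<le> norm a * norm b * norm (c::'a::real_normed_algebra)"
  by (rule order_trans[OF norm_mult_ineq]) (intro mult_right_mono norm_mult_ineq norm_ge_zero)

lemma projection_compl: "projection p \<Longrightarrow> projection (1 - p)"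
  by (simp add: projection_def algebra_simps star_diff)

lemma norm_projection_le:
  assumes "projection p"
  shows "norm p \<le> 1"
proof -
  have "norm p * norm p = norm p"
    using cstar_identity[of p] assms by (simp add: projection_def power2_eq_square)
  then show ?thesis by (cases "norm p = 0") auto
qed

text \<open>The summands are the powers of a single \<open>n\<close>-th root of unity with exponent
  \<open>k - 1\<close>, so the geometric sum vanishes unless \<open>n\<close> divides
  \<open>k - 1\<close>. Since \<open>k - 1\<close> lies between \<open>-1\<close> and
  \<open>n - 2\<close>, only \<open>k = 1\<close> qualifies; \<open>n \<ge> 2\<close> excludes
  \<open>k = 0\<close>.\<close>

lemma sum_root_of_unity_powers:
  assumes "k < n" and "n \<ge> 2"
  shows "(\<Sum>j<n. cnj (cis (2 * pi * real j / real n)) * cis (2 * pi * real j / real n) ^ k)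
    = (if k = 1 then of_nat n else 0)"
proof -
  define \<theta> where "\<theta> = 2 * pi * (real k - 1) / real n"
  have eq: "cnj (cis (2 * pi * real j / real n)) * cis (2 * pi * real j / real n) ^ k = cis \<theta> ^ j"
    for j
  proof -
    have "- (2 * pi * real j / real n) + real k * (2 * pi * real j / real n)
        = real j * (2 * pi * (real k - 1) / real n)"
      by (simp add: algebra_simps add_divide_distrib diff_divide_distrib)
    then show ?thesis
      unfolding cis_cnj Complex.DeMoivre cis_mult \<theta>_def by (simp only:)
  qed
  have "cis \<theta> ^ n = 1"
  proof -
    have e: "real n * \<theta> = 2 * pi * of_int (int k - 1)"
      using assms by (simp add: \<theta>_def)
    have "of_int (int k - 1) \<in> \<int>" by (rule Ints_of_int)
    then show ?thesis unfolding Complex.DeMoivre e by (rule cis_multiple_2pi)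
  qed
  moreover have "cis \<theta> \<noteq> 1" if "k \<noteq> 1"
  proof
    assume "cis \<theta> = 1"
    then have "cos \<theta> = 1" by (simp add: complex_eq_iff)
    then obtain m :: int where m: "\<theta> = of_int m * 2 * pi"
      by (auto simp: cos_one_2pi_int)
    then have "(2 * pi) * ((real k - 1) / real n) = (2 * pi) * of_int m"
      unfolding \<theta>_def by simp
    then have "(real k - 1) / real n = of_int m"
      by (subst (asm) mult_left_cancel) simp_all
    then have "real k - 1 = real n * of_int m" using assms by (simp add: field_simps)
    then have "of_int (int k - 1) = (of_int (int n * m) :: real)" by simp
    then have e: "int k - 1 = int n * m" by (simp only: of_int_eq_iff)
    have "m = 0 \<or> m \<ge> 1 \<or> m \<le> -1" by linarith
    then show False
    proof (elim disjE)
      assume "m \<ge> 1"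
      then have "int n * 1 \<le> int n * m" by (intro mult_left_mono) auto
      then show False using e assms by linarith
    next
      assume "m \<le> -1"
      then have "int n * m \<le> int n * (-1)" by (intro mult_left_mono) auto
      then show False using e assms by linarith
    qed (use e that in auto)
  qed
  ultimately show ?thesis
    unfolding eq by (auto simp: geometric_sum[of "cis \<theta>"]) (simp add: \<theta>_def)
qed

text \<open>
  Averaging \<open>(p + z h)\<^sup>n\<close> against \<open>cnj z\<close> over the roots of unity extracts the linear term
  \<open>n h\<close>, so the hypothesis bounds \<open>n \<cdot> norm h\<close> uniformly in \<open>n\<close>.
\<close>

lemma eq_zero_of_disc_bounded:
  fixes p h :: "'a::cstar_algebra"
  assumes pp: "p * p = p" and ph: "p * h = h" and hp: "h * p = h"
    and bound: "\<And>z. cmod z = 1 \<Longrightarrow> norm (p + z *\<^sub>C h) \<le> 1"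
  shows "h = 0"
proof -
  have expansion: "\<exists>c :: nat \<Rightarrow> 'a. c 0 = p \<and> c 1 = real (Suc m) *\<^sub>R h \<and>
      (\<forall>z. (p + z *\<^sub>C h) ^ Suc m = (\<Sum>k<m + 2. z ^ k *\<^sub>C c k))" for m
  proof (induction m)
    case 0
    show ?case
      by (rule exI[of _ "\<lambda>k. if k = 0 then p else h"]) (simp add: numeral_2_eq_2 scaleC_simps)
  next
    case (Suc m)
    then obtain c :: "nat \<Rightarrow> 'a" where c0: "c 0 = p" and c1: "c 1 = real (Suc m) *\<^sub>R h"
      and c: "\<And>z. (p + z *\<^sub>C h) ^ Suc m = (\<Sum>k<m + 2. z ^ k *\<^sub>C c k)"
      by blast
    \<comment> \<open>These are the coefficients after one more right multiplication by
      \<open>p + z h\<close>. The guards cut off indices at which \<open>c\<close> is unspecified or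
      \<open>k - 1\<close> would be truncated.\<close>
    define c' where "c' k = (if k < m + 2 then c k * p else 0) + (if k = 0 then 0 else c (k - 1) * h)"
      for k
    have "(p + z *\<^sub>C h) ^ Suc (Suc m) = (\<Sum>k<Suc m + 2. z ^ k *\<^sub>C c' k)" for z
    proof -
      have "(p + z *\<^sub>C h) ^ Suc (Suc m) = (\<Sum>k<m + 2. z ^ k *\<^sub>C c k) * (p + z *\<^sub>C h)"
        by (simp only: power_Suc2[of _ "Suc m"] c)
      also have "\<dots> = (\<Sum>k<m + 2. z ^ k *\<^sub>C (c k * p)) + (\<Sum>k<m + 2. z ^ Suc k *\<^sub>C (c k * h))"
        by (simp add: sum_distrib_right distrib_left mult_scaleC_left mult_scaleC_right
          scaleC_scaleC sum.distrib complex_vector.scale_sum_right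
          del: sum.lessThan_Suc)
      also have "(\<Sum>k<m + 2. z ^ k *\<^sub>C (c k * p))
          = (\<Sum>k<Suc m + 2. z ^ k *\<^sub>C (if k < m + 2 then c k * p else 0))"
        by (simp add: scaleC_simps)
      also have "(\<Sum>k<m + 2. z ^ Suc k *\<^sub>C (c k * h))
          = (\<Sum>k<Suc m + 2. z ^ k *\<^sub>C (if k = 0 then 0 else c (k - 1) * h))"
        unfolding add_Suc sum.lessThan_Suc_shift by (simp add: scaleC_simps del: sum.lessThan_Suc)
      finally show ?thesis
        unfolding c'_def scaleC_add_right sum.distrib .
    qed
    moreover have "c' 0 = p" by (simp add: c'_def c0 pp)
    moreover have "c' 1 = real (Suc (Suc m)) *\<^sub>R h"
    proof -
      have "c' 1 = real (Suc m) *\<^sub>R h + 1 *\<^sub>R h"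
        using c0 c1 by (simp add: c'_def ph hp)
      also have "\<dots> = (real (Suc m) + 1) *\<^sub>R h" by (simp only: scaleR_left_distrib)
      finally show ?thesis by (simp add: add.commute)
    qed
    ultimately show ?case by blast
  qed
  have "real (Suc m) * norm h \<le> 1" for m
  proof -
    obtain c :: "nat \<Rightarrow> 'a" where c1: "c 1 = real (Suc m) *\<^sub>R h"
      and c: "\<And>z. (p + z *\<^sub>C h) ^ Suc m = (\<Sum>k<m + 2. z ^ k *\<^sub>C c k)"
      using expansion[of m] by blast
    \<comment> \<open>With as many roots of unity as coefficients, averaging isolates the index 1
      without aliasing.\<close>
    define n where "n = m + 2"
    define w where "w j = cis (2 * pi * real j / real n)" for j
    have "(\<Sum>j<n. cnj (w j) *\<^sub>C (p + w j *\<^sub>C h) ^ Suc m)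
        = (\<Sum>j<n. \<Sum>k<n. (cnj (w j) * w j ^ k) *\<^sub>C c k)"
      unfolding c n_def[symmetric]
      by (simp add: complex_vector.scale_sum_right scaleC_scaleC)
    also have "\<dots> = (\<Sum>k<n. (\<Sum>j<n. cnj (w j) * w j ^ k) *\<^sub>C c k)"
      by (subst sum.swap) (simp add: complex_vector.scale_sum_left)
    also have "\<dots> = (\<Sum>k<n. (if k = 1 then of_nat n else 0) *\<^sub>C c k)"
      unfolding w_def
      by (intro sum.cong refl, subst sum_root_of_unity_powers) (auto simp: n_def)
    also have "\<dots> = (\<Sum>k<n. if k = 1 then of_nat n *\<^sub>C c k else 0)"
      by (intro sum.cong refl) (auto simp: scaleC_simps)
    also have "\<dots> = of_nat n *\<^sub>C c 1"
      by (subst sum.delta) (auto simp: n_def)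
    finally have "real n * norm (c 1) = norm (\<Sum>j<n. cnj (w j) *\<^sub>C (p + w j *\<^sub>C h) ^ Suc m)"
      by (simp add: norm_scaleC)
    also have "\<dots> \<le> (\<Sum>j<n. 1)"
    proof (rule sum_norm_le)
      fix j
      have "norm (p + w j *\<^sub>C h) \<le> 1" by (rule bound) (simp add: w_def)
      then have "norm ((p + w j *\<^sub>C h) ^ Suc m) \<le> 1"
        using norm_power_ineq[of "p + w j *\<^sub>C h" "Suc m"] by (meson norm_ge_zero order_trans power_le_one)
      then show "norm (cnj (w j) *\<^sub>C (p + w j *\<^sub>C h) ^ Suc m) \<le> 1"
        by (simp add: norm_scaleC w_def)
    qed
    finally have "real n * norm (c 1) \<le> real n * 1" by simp
    then have "norm (c 1) \<le> 1"
      by (rule mult_left_le_imp_le) (simp add: n_def)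
    then show ?thesis unfolding c1 by simp
  qed
  then have "real m * norm h \<le> 1" for m
    by (cases m) auto
  then show ?thesis
    using reals_Archimedean3[of "norm h" ] by (metis linorder_not_less norm_le_zero_iff)
qed

text \<open>Averaging the squares of \<open>p + h\<close> and \<open>p - h\<close> bounds
  \<open>p + h * h\<close>. By the C*-identity this bounds \<open>p + \<i> h\<close> and
  \<open>p - \<i> h\<close> too. For \<open>cmod z = 1\<close> the element
  \<open>p + z h / 2\<close> is a convex combination of \<open>p\<close> and these four
  contractions, so the disc criterion applies to \<open>h / 2\<close>.\<close>

lemma eq_zero_of_bounded_perturbation:
  fixes p h :: "'a::cstar_algebra"
  assumes p: "projection p" and h: "star h = h" and ph: "p * h = h" and hp: "h * p = h"
    and plus: "norm (p + h) \<le> 1" and minus: "norm (p - h) \<le> 1"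
  shows "h = 0"
proof -
  have p': "p * p = p" "star p = p" using p by (auto simp: projection_def)
  have sq: "norm (p + h * h) \<le> 1"
  proof -
    have "2 *\<^sub>R (p + h * h) = (p + h) * (p + h) + (p - h) * (p - h)"
      by (simp add: algebra_simps p' ph hp scaleR_2)
    then have "norm (2 *\<^sub>R (p + h * h)) \<le> norm ((p + h) * (p + h)) + norm ((p - h) * (p - h))"
      by (metis norm_triangle_ineq)
    also have "\<dots> \<le> norm (p + h) * norm (p + h) + norm (p - h) * norm (p - h)"
      by (intro add_mono norm_mult_ineq)
    also have "\<dots> \<le> 1 * 1 + 1 * 1"
      by (intro add_mono mult_mono plus minus) auto
    finally show ?thesis by simp
  qed
  have i: "norm (p + c *\<^sub>C h) \<le> 1" if "c = \<i> \<or> c = -\<i>" for c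
  proof -
    have "star (p + c *\<^sub>C h) * (p + c *\<^sub>C h) = p + h * h"
      using that by (auto simp: star_add star_scaleC p' h ph hp algebra_simps mult_scaleC_left
        mult_scaleC_right scaleC_scaleC scaleC_simps)
    with sq have "(norm (p + c *\<^sub>C h))\<^sup>2 \<le> 1" by (simp flip: cstar_identity)
    then show ?thesis by (simp add: abs_square_le_1 abs_le_iff)
  qed
  have disc: "norm (p + z *\<^sub>C ((1/2) *\<^sub>R h)) \<le> 1" if "cmod z = 1" for z
  proof -
    define a b where "a = Re z / 2" and "b = Im z / 2"
    \<comment> \<open>The factor one half makes room for the convex combination: the real and
      imaginary parts of \<open>z\<close> may add up to more than 1 in absolute value, but never to
      more than 2.\<close>
    have ab: "\<bar>a\<bar> + \<bar>b\<bar> \<le> 1"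
      using that abs_Re_le_cmod[of z] abs_Im_le_cmod[of z] unfolding a_def b_def by linarith
    define A where "A = (if a \<ge> 0 then p + h else p - h)"
    define B where "B = (if b \<ge> 0 then p + \<i> *\<^sub>C h else p + (-\<i>) *\<^sub>C h)"
    have nA: "norm A \<le> 1" and nB: "norm B \<le> 1"
      using plus minus i[of "\<i>"] i[of "-\<i>"] by (simp_all add: A_def B_def)
    have z: "z *\<^sub>C ((1/2) *\<^sub>R h) = a *\<^sub>R h + b *\<^sub>R (\<i> *\<^sub>C h)"
    proof -
      have "z * complex_of_real (1/2) = complex_of_real a + complex_of_real b * \<i>"
        by (auto simp: complex_eq_iff a_def b_def)
      then show ?thesis
        by (simp only: scaleC_of_real[symmetric] scaleC_scaleC scaleC_add_left)
    qed
    have A: "\<bar>a\<bar> *\<^sub>R A = \<bar>a\<bar> *\<^sub>R p + a *\<^sub>R h"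
      by (auto simp: A_def algebra_simps)
    have B: "\<bar>b\<bar> *\<^sub>R B = \<bar>b\<bar> *\<^sub>R p + b *\<^sub>R (\<i> *\<^sub>C h)"
      by (auto simp: B_def algebra_simps scaleC_simps)
    have "p + z *\<^sub>C ((1/2) *\<^sub>R h) = (1 - \<bar>a\<bar> - \<bar>b\<bar>) *\<^sub>R p + \<bar>a\<bar> *\<^sub>R A + \<bar>b\<bar> *\<^sub>R B"
      unfolding z A B by (simp add: algebra_simps)
    also have "norm \<dots> \<le> norm ((1 - \<bar>a\<bar> - \<bar>b\<bar>) *\<^sub>R p) + norm (\<bar>a\<bar> *\<^sub>R A) + norm (\<bar>b\<bar> *\<^sub>R B)"
      by (intro norm_triangle_le add_mono order_refl)
    also have "\<dots> = (1 - \<bar>a\<bar> - \<bar>b\<bar>) * norm p + \<bar>a\<bar> * norm A + \<bar>b\<bar> * norm B"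
      using ab by simp
    also have "\<dots> \<le> (1 - \<bar>a\<bar> - \<bar>b\<bar>) * 1 + \<bar>a\<bar> * 1 + \<bar>b\<bar> * 1"
      using ab by (intro add_mono mult_left_mono nA nB norm_projection_le p) auto
    finally show ?thesis by simp
  qed
  have "(1/2) *\<^sub>R h = 0"
    by (rule eq_zero_of_disc_bounded[of p]) (use p' ph hp disc in auto)
  then show ?thesis by simp
qed

text \<open>
  In a general C*-algebra this needs no positivity theory: with \<open>h = p\<^sub>i p\<^sub>j p\<^sub>i / m\<close>, both
  \<open>p\<^sub>i - h\<close> and \<open>p\<^sub>i + h\<close> are contractions, the latter because \<open>(m - 1) + p\<^sub>i + p\<^sub>j\<close> is a sum of \<open>m\<close>
  projections.
\<close>

lemma projections_orthogonal:
  fixes p :: "'i \<Rightarrow> 'a::cstar_algebra"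
  assumes fin: "finite I" and p: "\<And>i. i \<in> I \<Longrightarrow> projection (p i)" and sum: "projection (sum p I)"
    and ij: "i \<in> I" "j \<in> I" "i \<noteq> j"
  shows "p i * p j = 0"
proof -
  define J where "J = I - {i, j}"
  \<comment> \<open>One projection for the whole sum, and one projection \<open>1 - p k\<close> for
    each index other than \<open>i\<close> and \<open>j\<close>.\<close>
  define m where "m = real (Suc (card J))"
  have m: "m > 0" by (simp add: m_def)
  have pi: "p i * p i = p i" "star (p i) = p i" and pj: "p j * p j = p j" "star (p j) = p j"
    using p ij by (auto simp: projection_def)
  have I: "sum p I = p i + (p j + sum p J)"
    using ij fin by (simp add: J_def sum.remove[of I i] sum.remove[of "I - {i}" j]
      Diff_insert2[symmetric] insert_commute)
  define t where "t = p i * p j * p i"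
  have "norm (m *\<^sub>R p i + t) \<le> m"
  proof -
    have "(\<Sum>k\<in>J. 1 - p k) = real (card J) *\<^sub>R 1 - sum p J"
      by (simp add: sum_subtractf scaleR_conv_of_real)
    then have X: "sum p I + (\<Sum>k\<in>J. 1 - p k) = (m - 1) *\<^sub>R 1 + p i + p j"
      by (simp add: I m_def)
    have "p i * ((m - 1) *\<^sub>R 1 + p i + p j) * p i = m *\<^sub>R p i + t"
      by (simp add: distrib_left distrib_right pi t_def right_diff_distrib left_diff_distrib
        scaleR_left_diff_distrib)
    then have "norm (m *\<^sub>R p i + t)
        \<le> norm (p i) * norm (sum p I + (\<Sum>k\<in>J. 1 - p k)) * norm (p i)"
      unfolding X[symmetric] using norm_mult_mult_le by metis
    also have "\<dots> \<le> 1 * m * 1"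
    proof (intro mult_mono norm_projection_le p ij)
      have "norm (\<Sum>k\<in>J. 1 - p k) \<le> (\<Sum>k\<in>J. 1)"
        by (rule sum_norm_le) (auto simp: J_def intro!: norm_projection_le projection_compl p)
      then show "norm (sum p I + (\<Sum>k\<in>J. 1 - p k)) \<le> m"
        using norm_projection_le[OF sum] norm_triangle_ineq[of "sum p I" "\<Sum>k\<in>J. 1 - p k"]
        by (simp add: m_def)
    qed (use m in auto)
    finally show ?thesis by simp
  qed
  moreover have "m *\<^sub>R (p i + (1 / m) *\<^sub>R t) = m *\<^sub>R p i + t"
    using m by (simp add: algebra_simps)
  ultimately have plus: "norm (p i + (1 / m) *\<^sub>R t) \<le> 1"
    using m by (metis abs_of_pos mult.right_neutral mult_le_cancel_left_pos norm_scaleR)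
  have norm_diff: "norm (p i - t) \<le> 1"
  proof -
    have "p i - t = p i * (1 - p j) * p i" by (simp add: algebra_simps pi t_def)
    then have "norm (p i - t) \<le> norm (p i) * norm (1 - p j) * norm (p i)"
      by (simp only: norm_mult_mult_le)
    also have "\<dots> \<le> 1 * 1 * 1"
      by (intro mult_mono norm_projection_le p ij projection_compl) auto
    finally show ?thesis by simp
  qed
  \<comment> \<open>This is a convex combination of \<open>p i\<close> and the contraction
    \<open>p i - t\<close>, the compression of \<open>1 - p j\<close> by \<open>p i\<close>.\<close>
  have minus: "norm (p i - (1 / m) *\<^sub>R t) \<le> 1"
  proof -
    have m1: "1 / m \<le> 1" by (simp add: m_def)
    have "p i - (1 / m) *\<^sub>R t = (1 - 1 / m) *\<^sub>R p i + (1 / m) *\<^sub>R (p i - t)"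
      by (simp add: algebra_simps)
    then have "norm (p i - (1 / m) *\<^sub>R t) \<le> (1 - 1 / m) * norm (p i) + (1 / m) * norm (p i - t)"
      using norm_triangle_ineq[of "(1 - 1 / m) *\<^sub>R p i" "(1 / m) *\<^sub>R (p i - t)"] m m1 by simp
    also have "\<dots> \<le> (1 - 1 / m) * 1 + (1 / m) * 1"
      using m m1 norm_diff norm_projection_le[OF p[OF ij(1)]] by (intro add_mono mult_left_mono) auto
    finally show ?thesis by simp
  qed
  have "(1 / m) *\<^sub>R t = 0"
  proof (rule eq_zero_of_bounded_perturbation[OF p[OF ij(1)] _ _ _ plus minus])
    show "star ((1 / m) *\<^sub>R t) = (1 / m) *\<^sub>R t"
      by (simp flip: scaleC_of_real add: star_scaleC t_def star_mult pi pj mult.assoc)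
    show "p i * (1 / m) *\<^sub>R t = (1 / m) *\<^sub>R t"
      by (simp add: t_def mult.assoc[symmetric] pi)
    show "(1 / m) *\<^sub>R t * p i = (1 / m) *\<^sub>R t"
      by (simp add: t_def mult.assoc pi)
  qed
  then have "t = 0" using m by simp
  \<comment> \<open>\<open>t\<close> is of the form \<open>star b * b\<close>, so its vanishing
    passes to \<open>b = p j * p i\<close> by the C*-identity.\<close>
  moreover have "star (p j * p i) * (p j * p i) = t"
    by (simp add: star_mult pi pj t_def mult.assoc) (simp add: mult.assoc[symmetric] pj)
  ultimately have "p j * p i = 0" using cstar_identity[of "p j * p i"] by simp
  then have "star (p j * p i) = 0" by simp
  then show ?thesis by (simp add: star_mult pi pj)
qed

section \<open>Cuntz--Krieger relations\<close>

lemma csubspace_closure: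
  assumes "csubspace (M :: 'a::cstar_algebra set)"
  shows "csubspace (closure M)"
proof (rule complex_vector.subspaceI)
  show "0 \<in> closure M"
    using complex_vector.subspace_0[OF assms] closure_subset by blast
next
  fix x y assume "x \<in> closure M" "y \<in> closure M"
  then obtain X Y where "\<And>n::nat. X n \<in> M" "X \<longlonglongrightarrow> x" "\<And>n::nat. Y n \<in> M" "Y \<longlonglongrightarrow> y"
    unfolding closure_sequential by blast
  then show "x + y \<in> closure M"
    unfolding closure_sequential using complex_vector.subspace_add[OF assms]
    by (intro exI[of _ "\<lambda>n. X n + Y n"]) (auto intro: tendsto_add)
next
  fix c x assume "x \<in> closure M"
  then obtain X where "\<And>n::nat. X n \<in> M" "X \<longlonglongrightarrow> x"
    unfolding closure_sequential by blast
  then show "c *\<^sub>C x \<in> closure M"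
    unfolding closure_sequential using complex_vector.subspace_scale[OF assms]
    by (intro exI[of _ "\<lambda>n. c *\<^sub>C X n"]) (auto intro: tendsto_scaleC)
qed

lemma closure_mult_invariant:
  fixes a :: "'a::cstar_algebra"
  assumes "\<And>m. m \<in> M \<Longrightarrow> a * m \<in> closure M" and "m \<in> closure M"
  shows "a * m \<in> closure M"
proof -
  have "(\<lambda>m. a * m) ` closure M \<subseteq> closure M"
    by (rule image_closure_subset) (use assms in \<open>auto intro!: continuous_intros\<close>)
  with assms(2) show ?thesis by auto
qed

lemma cstar_UNIV_simps [simp]:
  "carrier cstar_UNIV = UNIV" "a \<otimes>\<^bsub>cstar_UNIV\<^esub> b = a * b" "a \<oplus>\<^bsub>cstar_UNIV\<^esub> b = a + b"
  "\<one>\<^bsub>cstar_UNIV\<^esub> = 1" "\<zero>\<^bsub>cstar_UNIV\<^esub> = 0" "cscale cstar_UNIV = scaleC" "cstar cstar_UNIV = star"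
  by (simp_all add: cstar_UNIV_def)

lemma finsum_cstar_UNIV:
  assumes "finite A"
  shows "finsum cstar_UNIV f A = (sum f A :: 'a::cstar_algebra)"
proof -
  interpret B: cstar_algebra_on "cstar_UNIV :: 'a cstar_struct" by (rule cstar_algebra_on_UNIV)
  show ?thesis
    using assms by (induction A rule: finite_induct) (simp_all add: B.finsum_insert Pi_def)
qed

locale graph_cstar = fin_digraph E for E :: "('v, 'e) pre_digraph" +
  fixes P :: "'v \<Rightarrow> 'a::cstar_algebra" and S :: "'e \<Rightarrow> 'a"
  assumes transitive: "transitive_graph E" and graph_alg: "graph_cstar_algebra E P S"
begin

section \<open>Relations between single edges and vertices\<close>

lemma ck: "ck_family E cstar_UNIV P S"
  using graph_alg by (simp add: graph_cstar_algebra_def)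

lemma P_projection: "v \<in> verts E \<Longrightarrow> projection (P v)"
  using ck by (auto simp: ck_family_def projection_def)

lemma P_idem: "v \<in> verts E \<Longrightarrow> P v * P v = P v"
  and P_star: "v \<in> verts E \<Longrightarrow> star (P v) = P v"
  using P_projection by (auto simp: projection_def)

lemma P_mult: "v \<in> verts E \<Longrightarrow> w \<in> verts E \<Longrightarrow> P v * P w = (if v = w then P v else 0)"
  using ck by (auto simp: ck_family_def)

lemma S_star_S_self: "e \<in> arcs E \<Longrightarrow> star (S e) * S e = P (head E e)"
  using ck by (auto simp: ck_family_def)

lemma S_partial_isometry: "e \<in> arcs E \<Longrightarrow> S e * star (S e) * S e = S e"
  using ck by (auto simp: ck_family_def)

lemma S_partial_isometry': "e \<in> arcs E \<Longrightarrow> star (S e) * S e * star (S e) = star (S e)"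
  using arg_cong[OF S_partial_isometry, of e star] by (simp add: star_mult star_star mult.assoc)

text \<open>Transitivity provides a closed walk of positive length at \<open>v\<close>, whose first
  edge leaves \<open>v\<close>. Hence the summation relation of the Cuntz-Krieger family is
  available at every vertex.\<close>

lemma out_arcs_nonempty: "v \<in> verts E \<Longrightarrow> out_arcs E v \<noteq> {}"
proof -
  assume "v \<in> verts E"
  then obtain p where "p \<noteq> []" "awalk v p v"
    using transitive by (auto simp: transitive_graph_def)
  then show ?thesis by (cases p) (auto simp: awalk_Cons_iff)
qed

lemma P_eq_sum: "v \<in> verts E \<Longrightarrow> P v = (\<Sum>e\<in>out_arcs E v. S e * star (S e))"
  using ck out_arcs_nonempty by (auto simp: ck_family_def finsum_cstar_UNIV finite_out_arcs)

lemma range_projection: "e \<in> arcs E \<Longrightarrow> projection (S e * star (S e))"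
  using S_partial_isometry[of e]
  by (simp add: projection_def star_mult star_star mult.assoc[symmetric])

text \<open>Orthogonality of range projections is not among the axioms of \<open>ck_family\<close>.
  It follows because the range projections of the edges leaving a vertex sum to the projection of
  that vertex.\<close>

lemma S_star_S_tail:
  assumes "e \<in> arcs E" "f \<in> arcs E" "e \<noteq> f" "tail E e = tail E f"
  shows "star (S e) * S f = 0"
proof -
  have "S e * star (S e) * (S f * star (S f)) = 0"
  proof (rule projections_orthogonal[of "out_arcs E (tail E e)" "\<lambda>e. S e * star (S e)"])
    show "projection (\<Sum>g\<in>out_arcs E (tail E e). S g * star (S g))"
      using assms by (simp flip: P_eq_sum add: P_projection)
  qed (use assms range_projection in auto)
  then have "star (S e) * (S e * star (S e) * (S f * star (S f))) * S f = 0" by simp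
  moreover have "star (S e) * (S e * star (S e) * (S f * star (S f))) * S f
      = (star (S e) * S e * star (S e)) * (S f * star (S f) * S f)"
    by (simp only: mult.assoc)
  ultimately show ?thesis
    using assms by (simp add: S_partial_isometry S_partial_isometry')
qed

lemma P_tail_S: "e \<in> arcs E \<Longrightarrow> P (tail E e) * S e = S e"
proof -
  assume e: "e \<in> arcs E"
  have "P (tail E e) * S e = (\<Sum>f\<in>out_arcs E (tail E e). S f * (star (S f) * S e))"
    using e by (simp add: P_eq_sum sum_distrib_right mult.assoc)
  also have "\<dots> = (\<Sum>f\<in>out_arcs E (tail E e). if f = e then S e else 0)"
    using e by (intro sum.cong refl)
      (auto simp: S_star_S_tail S_partial_isometry[unfolded mult.assoc])
  also have "\<dots> = S e" using e by (simp add: finite_out_arcs)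
  finally show ?thesis .
qed

lemma P_S: "v \<in> verts E \<Longrightarrow> e \<in> arcs E \<Longrightarrow> P v * S e = (if v = tail E e then S e else 0)"
  using P_tail_S[of e] P_mult[of v "tail E e"] by (metis mult.assoc mult_zero_left tail_in_verts)

lemma S_P: "v \<in> verts E \<Longrightarrow> e \<in> arcs E \<Longrightarrow> S e * P v = (if v = head E e then S e else 0)"
proof -
  assume v: "v \<in> verts E" and e: "e \<in> arcs E"
  have h: "S e * P (head E e) = S e"
    using e by (simp flip: S_star_S_self add: mult.assoc[symmetric] S_partial_isometry)
  then have "S e * P v = S e * (P (head E e) * P v)"
    by (simp add: mult.assoc[symmetric])
  with v e h show ?thesis by (auto simp: P_mult)
qed

lemma star_S_P: "v \<in> verts E \<Longrightarrow> e \<in> arcs E \<Longrightarrow> star (S e) * P v = (if v = tail E e then star (S e) else 0)"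
  using arg_cong[OF P_S, of v e star] by (auto simp: star_mult P_star split: if_splits)

lemma P_star_S: "v \<in> verts E \<Longrightarrow> e \<in> arcs E \<Longrightarrow> P v * star (S e) = (if v = head E e then star (S e) else 0)"
  using arg_cong[OF S_P, of v e star] by (auto simp: star_mult P_star split: if_splits)

lemma S_star_S:
  assumes "e \<in> arcs E" "f \<in> arcs E"
  shows "star (S e) * S f = (if e = f then P (head E e) else 0)"
proof (cases "tail E e = tail E f")
  case False
  have "star (S e) * S f = star (S e) * P (tail E e) * (P (tail E f) * S f)"
    using assms by (simp add: P_tail_S star_S_P)
  also have "\<dots> = star (S e) * (P (tail E e) * P (tail E f)) * S f" by (simp only: mult.assoc)
  also have "\<dots> = 0" using assms False by (simp add: P_mult)
  finally show ?thesis using False by auto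
qed (use assms S_star_S_tail S_star_S_self in auto)

text \<open>This serves as an induction principle: a property of all elements follows once the
  elements having it form a C*-subalgebra that contains the generators.\<close>

lemma generated:
  assumes "cstar_subalgebra C" and "\<And>v. v \<in> verts E \<Longrightarrow> P v \<in> C" and "\<And>e. e \<in> arcs E \<Longrightarrow> S e \<in> C"
  shows "a \<in> C"
proof -
  have "cstar_subalgebra hull (P ` verts E \<union> S ` arcs E) \<subseteq> C"
    by (rule hull_minimal) (use assms in auto)
  then show ?thesis using graph_alg by (auto simp: graph_cstar_algebra_def)
qed

text \<open>The elements for which \<open>Q\<close> is a two-sided unit form a C*-subalgebra
  containing all generators. It is therefore everything, and contains 1 in particular.\<close>

lemma sum_P: "(\<Sum>v\<in>verts E. P v) = 1"
proof -
  define Q where "Q = (\<Sum>v\<in>verts E. P v)"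
  have Qstar: "star Q = Q" by (simp add: Q_def star_sum P_star)
  have "1 \<in> {a. Q * a = a \<and> a * Q = a}"
  proof (rule generated)
    show "cstar_subalgebra {a. Q * a = a \<and> a * Q = a}"
      unfolding cstar_subalgebra_def
    proof (intro conjI ballI)
      show "csubspace {a. Q * a = a \<and> a * Q = a}"
        by (rule complex_vector.subspaceI)
          (auto simp: distrib_left distrib_right mult_scaleC_left mult_scaleC_right)
      show "closed {a. Q * a = a \<and> a * Q = a}"
        by (intro closed_Collect_conj closed_Collect_eq continuous_intros)
    next
      fix a assume "a \<in> {a. Q * a = a \<and> a * Q = a}"
      then have "star (Q * a) = star a" "star (a * Q) = star a" by auto
      then show "star a \<in> {a. Q * a = a \<and> a * Q = a}" by (simp add: star_mult Qstar)
    next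
      fix a b assume "a \<in> {a. Q * a = a \<and> a * Q = a}" "b \<in> {a. Q * a = a \<and> a * Q = a}"
      then show "a * b \<in> {a. Q * a = a \<and> a * Q = a}"
        by (metis (mono_tags, lifting) mem_Collect_eq mult.assoc)
    qed
  next
    fix v assume "v \<in> verts E"
    then show "P v \<in> {a. Q * a = a \<and> a * Q = a}"
      by (simp add: Q_def sum_distrib_left sum_distrib_right P_mult)
  next
    fix e assume "e \<in> arcs E"
    then show "S e \<in> {a. Q * a = a \<and> a * Q = a}"
      by (simp add: Q_def sum_distrib_left sum_distrib_right P_S S_P)
  qed
  then show ?thesis by (simp add: Q_def)
qed

lemma sum_arcs_tail: "(\<Sum>e\<in>arcs E. f e) = (\<Sum>v\<in>verts E. \<Sum>e\<in>out_arcs E v. f e)"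
  by (subst sum.group[of "arcs E" "verts E" "tail E", symmetric]) (auto simp: out_arcs_def)

lemma sum_S_S_star: "(\<Sum>e\<in>arcs E. S e * star (S e)) = 1"
  using sum_P by (simp add: sum_arcs_tail P_eq_sum)

section \<open>Path elements and their products\<close>

abbreviation T :: "'v \<Rightarrow> 'e list \<Rightarrow> 'a"
  where "T v p \<equiv> path_elem P S (v, p)"

lemma T_Nil [simp]: "T v [] = P v"
  by (simp add: path_elem_def)

lemma T_single: "T v [e] = S e"
  by (simp add: path_elem_def)

lemma awalk_snoc: "awalk v p w \<Longrightarrow> e \<in> out_arcs E w \<Longrightarrow> awalk v (p @ [e]) (head E e)"
  by (rule awalk_appendI) (auto simp: awalk_Cons_iff awalk_Nil_iff)

lemma T_Cons: "awalk v (e # p) w \<Longrightarrow> T v (e # p) = S e * T (head E e) p"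
  by (auto simp: path_elem_def awalk_Cons_iff S_P)

lemma T_snoc: "awalk v (p @ [e]) w \<Longrightarrow> T v (p @ [e]) = T v p * S e"
  by (auto simp: path_elem_def awalk_Cons_iff awalk_Nil_iff P_tail_S)

lemma P_T: "awalk v p w \<Longrightarrow> x \<in> verts E \<Longrightarrow> P x * T v p = (if x = v then T v p else 0)"
  by (cases p) (auto simp: T_Cons awalk_Cons_iff awalk_Nil_iff P_mult mult.assoc[symmetric] P_S)

lemma T_P: "awalk v p w \<Longrightarrow> x \<in> verts E \<Longrightarrow> T v p * P x = (if x = w then T v p else 0)"
proof (induction p arbitrary: v)
  case (Cons e p)
  then have "awalk (head E e) p w" by (simp add: awalk_Cons_iff)
  from Cons.IH[OF this Cons.prems(2)] show ?case
    by (simp add: T_Cons[OF Cons.prems(1)] mult.assoc)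
qed (auto simp: awalk_Nil_iff P_mult)

lemma star_T_P: "awalk v p w \<Longrightarrow> x \<in> verts E \<Longrightarrow> star (T v p) * P x = (if x = v then star (T v p) else 0)"
  using arg_cong[OF P_T, of v p w x star] by (auto simp: star_mult P_star split: if_splits)

lemma P_star_T: "awalk v p w \<Longrightarrow> x \<in> verts E \<Longrightarrow> P x * star (T v p) = (if x = w then star (T v p) else 0)"
  using arg_cong[OF T_P, of v p w x star] by (auto simp: star_mult P_star split: if_splits)

text \<open>The first edges meet in the middle and leave either 0 or a vertex projection, which the
  remaining path absorbs; then induct on the common length.\<close>

lemma star_T_T:
  assumes "awalk v p w" "awalk v' p' w'" "length p = length p'"
  shows "star (T v p) * T v' p' = (if v = v' \<and> p = p' then P w else 0)"
  using assms(3,1,2)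
proof (induction p p' arbitrary: v v' rule: list_induct2)
  case Nil
  then show ?case by (auto simp: awalk_Nil_iff P_star P_mult)
next
  case (Cons e p f p')
  have e: "e \<in> arcs E" "v = tail E e" "awalk (head E e) p w"
    and f: "f \<in> arcs E" "v' = tail E f" "awalk (head E f) p' w'"
    using Cons.prems by (auto simp: awalk_Cons_iff)
  have "star (T v (e # p)) * T v' (f # p')
      = star (T (head E e) p) * (star (S e) * S f) * T (head E f) p'"
    using Cons.prems by (simp add: T_Cons star_mult mult.assoc)
  also have "\<dots> = (if e = f then star (T (head E e) p) * T (head E f) p' else 0)"
    using e f by (auto simp: S_star_S star_T_P)
  finally show ?case using Cons.IH[OF e(3) f(3)] e f by auto
qed

lemma T_partial_isometry:
  assumes "awalk v p w"
  shows "T v p * star (T v p) * T v p = T v p"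
proof -
  have "w \<in> verts E" using assms by auto
  then show ?thesis using assms by (simp add: mult.assoc star_T_T T_P)
qed

lemma mem_paths_iff: "(v, p) \<in> paths E k \<longleftrightarrow> length p = k \<and> (\<exists>w. awalk v p w)"
  by (simp add: paths_def)

lemma path_range_eq: "awalk v p w \<Longrightarrow> path_range E (v, p) = w"
  by (simp add: path_range_def)

section \<open>Density of the span of products of path elements with adjoints of path
  elements\<close>

text \<open>The two ranges may differ. Such products are zero, and admitting them saves a side
  condition.\<close>

definition words :: "'a set"
  where "words = {T v p * star (T v' p') | v p w v' p' w'. awalk v p w \<and> awalk v' p' w'}"

lemma wordsI: "awalk v p w \<Longrightarrow> awalk v' p' w' \<Longrightarrow> T v p * star (T v' p') \<in> cspan words"
  by (rule complex_vector.span_base) (unfold words_def, blast)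

text \<open>This is the input for the density argument: left multiplication by any generator or its
  adjoint preserves the span of \<open>words\<close>.\<close>

lemma generator_words:
  assumes "awalk v p w" "awalk v' p' w'"
  shows "x \<in> verts E \<Longrightarrow> P x * (T v p * star (T v' p')) \<in> cspan words"
    and "e \<in> arcs E \<Longrightarrow> S e * (T v p * star (T v' p')) \<in> cspan words"
    and "e \<in> arcs E \<Longrightarrow> star (S e) * (T v p * star (T v' p')) \<in> cspan words"
proof -
  show "P x * (T v p * star (T v' p')) \<in> cspan words" if "x \<in> verts E"
    using that assms by (auto simp: mult.assoc[symmetric] P_T wordsI complex_vector.span_zero)
next
  assume e: "e \<in> arcs E"
  have v: "v \<in> verts E" using assms(1) by auto
  show "S e * (T v p * star (T v' p')) \<in> cspan words"
  proof (cases "v = head E e")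
    case True
    then have aw: "awalk (tail E e) (e # p) w" using e assms by (simp add: awalk_Cons_iff)
    then have "S e * (T v p * star (T v' p')) = T (tail E e) (e # p) * star (T v' p')"
      using True by (simp add: T_Cons mult.assoc)
    then show ?thesis using wordsI[OF aw assms(2)] by simp
  next
    case False
    have "S e * T v p = S e * (P v * T v p)" using assms(1) v by (simp add: P_T)
    also have "\<dots> = 0" using False e v by (simp add: mult.assoc[symmetric] S_P)
    finally show ?thesis by (simp add: mult.assoc[symmetric] complex_vector.span_zero)
  qed
  show "star (S e) * (T v p * star (T v' p')) \<in> cspan words"
  proof (cases p)
    \<comment> \<open>There is no first edge to cancel, so the adjoint of \<open>S e\<close> is
      absorbed on the other side, where it lengthens \<open>p'\<close> by \<open>e\<close>.\<close>
    case Nil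
    have w': "w' \<in> verts E" using assms(2) by auto
    show ?thesis
    proof (cases "v = tail E e \<and> w' = tail E e")
      case True
      then have aw: "awalk v' (p' @ [e]) (head E e)"
        using assms(2) e by (auto simp: awalk_Cons_iff awalk_Nil_iff)
      have "P (head E e) * star (T v' (p' @ [e])) = P (head E e) * star (S e) * star (T v' p')"
        by (simp only: T_snoc[OF aw] star_mult mult.assoc)
      then have "star (S e) * (T v p * star (T v' p')) = P (head E e) * star (T v' (p' @ [e]))"
        using True Nil e by (simp add: mult.assoc[symmetric] star_S_P P_star_S)
      also have "\<dots> = T (head E e) [] * star (T v' (p' @ [e]))" by simp
      finally show ?thesis
        using wordsI[OF _ aw, of "head E e" "[]" "head E e"] e by (simp add: awalk_Nil_iff)
    next
      case False
      have "star (S e) * P v * star (T v' p') = 0"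
      proof (cases "v = tail E e")
        case True
        have "star (S e) * star (T v' p') = star (S e) * (P w' * star (T v' p'))"
          using assms(2) w' by (simp add: P_star_T)
        also have "\<dots> = 0" using False True e w' by (simp add: mult.assoc[symmetric] star_S_P)
        finally show ?thesis using True e by (simp add: star_S_P)
      qed (use e v in \<open>simp add: star_S_P\<close>)
      then show ?thesis by (simp add: Nil mult.assoc[symmetric] complex_vector.span_zero)
    qed
  next
    case (Cons f q)
    then have f: "f \<in> arcs E" "awalk (head E f) q w" using assms by (auto simp: awalk_Cons_iff)
    have "star (S e) * (T v p * star (T v' p')) = star (S e) * S f * T (head E f) q * star (T v' p')"
      using assms(1) Cons by (simp add: T_Cons mult.assoc)
    also have "\<dots> = (if e = f then T (head E f) q * star (T v' p') else 0)"
      using e f by (auto simp: S_star_S P_T)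
    finally show ?thesis
      using wordsI[OF f(2) assms(2)] by (auto simp: complex_vector.span_zero)
  qed
qed

text \<open>The elements that, together with their adjoints, map the closed span into itself by left
  multiplication form a C*-subalgebra \<open>L\<close> containing the generators, so
  \<open>L\<close> is everything. As the closed span contains 1, it contains \<open>a * 1\<close>
  for every \<open>a\<close>.\<close>

lemma words_dense: "a \<in> closure (cspan words)"
proof -
  let ?M = "cspan words"
  let ?N = "closure ?M"
  define L where "L = (\<Inter>m\<in>?N. {a. a * m \<in> ?N} \<inter> {a. star a * m \<in> ?N})"
  have N: "csubspace ?N" by (intro csubspace_closure complex_vector.subspace_span)
  have left: "g * m \<in> ?N"
    if "\<And>v p w v' p' w'. awalk v p w \<Longrightarrow> awalk v' p' w' \<Longrightarrow> g * (T v p * star (T v' p')) \<in> ?M"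
      and "m \<in> ?N" for g m
  proof (rule closure_mult_invariant[OF _ that(2)])
    fix m assume "m \<in> ?M"
    then have "g * m \<in> ?M"
    proof (induction rule: complex_vector.span_induct)
      case base
      show ?case
        by (rule complex_vector.subspaceI) (auto simp: distrib_left mult_scaleC_right
          intro: complex_vector.span_zero complex_vector.span_add complex_vector.span_scale)
    next
      case (step x)
      then show ?case using that(1) by (auto simp: words_def)
    qed
    then show "g * m \<in> ?N" using closure_subset by blast
  qed
  have "a \<in> L"
  proof (rule generated)
    show "cstar_subalgebra L"
      unfolding cstar_subalgebra_def
    proof (intro conjI ballI)
      show "csubspace L"
        by (rule complex_vector.subspaceI)
          (auto simp: L_def distrib_right star_add star_scaleC mult_scaleC_left
            intro: complex_vector.subspace_0[OF N] complex_vector.subspace_add[OF N]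
              complex_vector.subspace_scale[OF N])
      have cl: "closed {a. f a \<in> ?N}" if "continuous_on UNIV f" for f :: "'a \<Rightarrow> 'a"
        using closed_vimage[OF closed_closure that, of ?M] by (simp add: vimage_def)
      then show "closed L"
        unfolding L_def
        by (intro closed_INT ballI closed_Int cl continuous_intros
          bounded_linear.continuous_on[OF bounded_linear_star])
    next
      fix a assume "a \<in> L"
      then show "star a \<in> L" by (simp add: L_def star_star)
    next
      fix a b assume "a \<in> L" "b \<in> L"
      then show "a * b \<in> L" by (simp add: L_def star_mult mult.assoc)
    qed
  next
    fix v assume "v \<in> verts E"
    then show "P v \<in> L"
      unfolding L_def by (simp add: P_star) (blast intro: left generator_words)
  next
    fix e assume "e \<in> arcs E"
    then show "S e \<in> L"
      unfolding L_def by simp (blast intro: left generator_words)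
  qed
  moreover have "1 \<in> ?N"
  proof -
    have "P v \<in> ?M" if "v \<in> verts E" for v
      using wordsI[of v "[]" v v "[]" v] that by (simp add: awalk_Nil_iff P_star P_idem)
    then have "1 \<in> ?M" unfolding sum_P[symmetric] by (intro complex_vector.span_sum)
    then show ?thesis using closure_subset by blast
  qed
  ultimately show ?thesis unfolding L_def by fastforce
qed

text \<open>Only the second path has a prescribed length: it is the one that will be adjacent to
  \<open>Q\<close>.\<close>

definition level_words :: "nat \<Rightarrow> 'a set"
  where "level_words k =
    {T v p * star (T v' p') | v p w v' p' w'. awalk v p w \<and> awalk v' p' w' \<and> length p' = k}"

text \<open>Writing the common range projection as the sum of \<open>S e * star (S e)\<close> over
  its outgoing edges lengthens both paths by one edge. Iterating this reaches any larger length of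
  the second path.\<close>

lemma span_level_words:
  assumes "awalk v p w" "awalk v' p' w'"
  shows "T v p * star (T v' p') \<in> cspan (level_words (length p' + j))"
  using assms
proof (induction j arbitrary: p p' w w')
  case 0
  then show ?case
    unfolding level_words_def add_0_right by (intro complex_vector.span_base) blast
next
  case (Suc j)
  have w: "w \<in> verts E" "w' \<in> verts E" using Suc.prems by auto
  have "T v p * star (T v' p') = T v p * (P w * P w') * star (T v' p')"
  proof -
    have "T v p * star (T v' p') = T v p * P w * (P w' * star (T v' p'))"
      using Suc.prems w by (simp add: T_P P_star_T)
    then show ?thesis by (simp only: mult.assoc)
  qed
  show ?case
  proof (cases "w = w'")
    case True
    have "T v p * star (T v' p') = T v p * P w * star (T v' p')"
      using Suc.prems w by (simp add: T_P)
    also have "\<dots> = (\<Sum>e\<in>out_arcs E w. T v (p @ [e]) * star (T v' (p' @ [e])))"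
      unfolding P_eq_sum[OF w(1)] sum_distrib_left sum_distrib_right
    proof (intro sum.cong refl)
      fix e assume e: "e \<in> out_arcs E w"
      show "T v p * (S e * star (S e)) * star (T v' p') = T v (p @ [e]) * star (T v' (p' @ [e]))"
        using e True unfolding T_snoc[OF awalk_snoc[OF Suc.prems(1) e]]
          T_snoc[OF awalk_snoc[OF Suc.prems(2) e[unfolded True]]] star_mult
        by (simp only: mult.assoc)
    qed
    also have "\<dots> \<in> cspan (level_words (length p' + Suc j))"
    proof (rule complex_vector.span_sum)
      fix e assume e: "e \<in> out_arcs E w"
      show "T v (p @ [e]) * star (T v' (p' @ [e])) \<in> cspan (level_words (length p' + Suc j))"
        using Suc.IH[OF awalk_snoc[OF Suc.prems(1) e] awalk_snoc[OF Suc.prems(2) e[unfolded True]]]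
        by simp
    qed
    finally show ?thesis .
  next
    case False
    have "T v p * star (T v' p') = T v p * (P w * P w') * star (T v' p')" by fact
    also have "\<dots> = 0" using False w by (simp add: P_mult)
    finally show ?thesis by (simp add: complex_vector.span_zero)
  qed
qed

end

section \<open>The shift and the levels of diagonal and core\<close>

context graph_cstar
begin

section \<open>Multiplicativity and commutation properties of the shift\<close>

abbreviation \<phi> :: "'a \<Rightarrow> 'a"
  where "\<phi> \<equiv> shift E S"

text \<open>In \<open>\<phi> a * \<phi> b\<close> a vertex projection separates \<open>a\<close>
  from \<open>b\<close> inside each summand. For such \<open>a\<close> the projection can be moved
  to the neighbouring edge and disappears.\<close>

definition vertex_comm :: "'a \<Rightarrow> bool"
  where "vertex_comm a \<longleftrightarrow> (\<forall>v\<in>verts E. P v * a = a * P v)"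

lemma vertex_commD: "vertex_comm a \<Longrightarrow> v \<in> verts E \<Longrightarrow> P v * a = a * P v"
  by (simp add: vertex_comm_def)

lemma vertex_comm_one: "vertex_comm 1"
  by (simp add: vertex_comm_def)

lemma vertex_comm_mult: "vertex_comm a \<Longrightarrow> vertex_comm b \<Longrightarrow> vertex_comm (a * b)"
  unfolding vertex_comm_def by (simp add: mult.assoc[symmetric]) (simp add: mult.assoc)

lemma vertex_comm_star: "vertex_comm a \<Longrightarrow> vertex_comm (star a)"
  unfolding vertex_comm_def by (metis P_star star_mult)

lemma shift_S: "f \<in> arcs E \<Longrightarrow> \<phi> a * S f = S f * a * P (head E f)"
proof -
  assume f: "f \<in> arcs E"
  have "\<phi> a * S f = (\<Sum>e\<in>arcs E. if e = f then S f * a * P (head E f) else 0)"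
    unfolding shift_def sum_distrib_right
    by (intro sum.cong refl) (use f in \<open>auto simp: mult.assoc S_star_S\<close>)
  then show ?thesis using f by simp
qed

lemma P_S_mult: "v \<in> verts E \<Longrightarrow> e \<in> arcs E \<Longrightarrow> P v * (S e * x) = (if v = tail E e then S e * x else 0)"
  by (simp add: mult.assoc[symmetric] P_S)

lemma S_P_mult: "e \<in> arcs E \<Longrightarrow> S e * (P (head E e) * a) = S e * a"
  by (simp add: mult.assoc[symmetric] S_P)

text \<open>No condition on \<open>a\<close> is imposed: each summand begins with \<open>S e\<close>
  and ends with its adjoint, so a vertex projection on either side selects the same edges.\<close>

lemma vertex_comm_shift: "vertex_comm (\<phi> a)"
  unfolding vertex_comm_def shift_def sum_distrib_left sum_distrib_right
  by (intro ballI sum.cong refl) (auto simp: mult.assoc star_S_P P_S_mult)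

lemma shift_vertex_comm_S:
  assumes "vertex_comm a" "f \<in> arcs E"
  shows "\<phi> a * S f = S f * a"
proof -
  have "\<phi> a * S f = S f * (P (head E f) * a)"
    using assms vertex_commD[of a "head E f"] by (simp add: shift_S mult.assoc)
  then show ?thesis using assms by (simp add: S_P_mult)
qed

lemma shift_mult:
  assumes "vertex_comm a"
  shows "\<phi> (a * b) = \<phi> a * \<phi> b"
proof -
  have "\<phi> a * \<phi> b = (\<Sum>f\<in>arcs E. \<phi> a * S f * b * star (S f))"
    by (simp add: shift_def[of E S b] sum_distrib_left mult.assoc)
  also have "\<dots> = \<phi> (a * b)"
    unfolding shift_def[of E S "a * b"]
  proof (intro sum.cong refl)
    fix f assume f: "f \<in> arcs E"
    show "\<phi> a * S f * b * star (S f) = S f * (a * b) * star (S f)"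
      using f assms by (simp add: shift_vertex_comm_S mult.assoc)
  qed
  finally show ?thesis ..
qed

lemma shift_one: "\<phi> 1 = 1"
  by (simp add: shift_def sum_S_S_star)

lemma shift_star: "\<phi> (star a) = star (\<phi> a)"
  by (simp add: shift_def star_sum star_mult star_star mult.assoc)

lemma shift_prod_0 [simp]: "shift_prod E S a 0 = 1"
  by (simp add: shift_prod_def)

lemma vertex_comm_shift_pow: "vertex_comm a \<Longrightarrow> vertex_comm ((\<phi> ^^ j) a)"
  by (cases j) (auto simp: vertex_comm_shift)

lemma shift_prod_list:
  assumes "\<And>x. x \<in> set xs \<Longrightarrow> vertex_comm x"
  shows "prod_list (map \<phi> xs) = \<phi> (prod_list xs)"
  using assms by (induction xs) (auto simp: shift_one shift_mult)

text \<open>All factors but the first are images under \<open>\<phi>\<close>, and multiplicativity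
  collects them into the image of the shorter product. This recursion drives the later inductions on
  \<open>n\<close>.\<close>

lemma shift_prod_Suc:
  assumes "vertex_comm a"
  shows "shift_prod E S a (Suc n) = a * \<phi> (shift_prod E S a n)"
proof -
  have "[0..<Suc n] = 0 # map Suc [0..<n]"
    by (simp only: map_Suc_upt upt_conv_Cons zero_less_Suc)
  then have "map (\<lambda>j. (\<phi> ^^ j) a) [0..<Suc n] = a # map \<phi> (map (\<lambda>j. (\<phi> ^^ j) a) [0..<n])"
    by (simp add: o_def del: upt_Suc)
  then have "shift_prod E S a (Suc n) = a * prod_list (map \<phi> (map (\<lambda>j. (\<phi> ^^ j) a) [0..<n]))"
    unfolding shift_prod_def by (simp only: prod_list.Cons)
  also have "\<dots> = a * \<phi> (shift_prod E S a n)"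
    unfolding shift_prod_def
    by (subst shift_prod_list) (auto simp: vertex_comm_shift_pow[OF assms])
  finally show ?thesis .
qed

lemma vertex_comm_shift_prod: "vertex_comm a \<Longrightarrow> vertex_comm (shift_prod E S a n)"
  by (cases n) (auto simp: shift_prod_Suc vertex_comm_one intro!: vertex_comm_mult vertex_comm_shift)

lemma unitary_shift: "vertex_comm a \<Longrightarrow> unitary a \<Longrightarrow> unitary (\<phi> a)"
  using shift_mult[of a "star a"] shift_mult[OF vertex_comm_star, of a a]
  by (simp add: unitary_def shift_star shift_one)

lemma unitary_shift_prod: "vertex_comm a \<Longrightarrow> unitary a \<Longrightarrow> unitary (shift_prod E S a n)"
proof (induction n)
  case 0
  show ?case by (simp add: unitary_def)
next
  case (Suc n)
  then show ?case
    by (simp add: shift_prod_Suc unitary_mult unitary_shift vertex_comm_shift_prod)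
qed

section \<open>The diagonal and core levels\<close>

lemma paths_1D: "\<mu> \<in> paths E 1 \<Longrightarrow> \<exists>e\<in>arcs E. \<mu> = (tail E e, [e])"
  by (cases \<mu>) (auto simp: mem_paths_iff length_Suc_conv awalk_Cons_iff)

lemma paths_1I: "e \<in> arcs E \<Longrightarrow> (tail E e, [e]) \<in> paths E 1"
  by (auto simp: mem_paths_iff awalk_Cons_iff awalk_Nil_iff)

lemma core_level_1: "core_level E P S 1 = cspan {S e * star (S f) | e f. e \<in> arcs E \<and> f \<in> arcs E}"
proof -
  have "{path_elem P S \<mu> * star (path_elem P S \<nu>) | \<mu> \<nu>. \<mu> \<in> paths E 1 \<and> \<nu> \<in> paths E 1}
      = {S e * star (S f) | e f. e \<in> arcs E \<and> f \<in> arcs E}"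
  proof (intro Set.set_eqI iffI)
    fix x assume "x \<in> {S e * star (S f) | e f. e \<in> arcs E \<and> f \<in> arcs E}"
    then obtain e f where "x = T (tail E e) [e] * star (T (tail E f) [f])" "e \<in> arcs E" "f \<in> arcs E"
      unfolding T_single by blast
    with paths_1I
    show "x \<in> {path_elem P S \<mu> * star (path_elem P S \<nu>) | \<mu> \<nu>. \<mu> \<in> paths E 1 \<and> \<nu> \<in> paths E 1}"
      by blast
  next
    fix x assume "x \<in> {path_elem P S \<mu> * star (path_elem P S \<nu>) | \<mu> \<nu>. \<mu> \<in> paths E 1 \<and> \<nu> \<in> paths E 1}"
    then obtain \<mu> \<nu> where x: "x = path_elem P S \<mu> * star (path_elem P S \<nu>)"
      and "\<mu> \<in> paths E 1" "\<nu> \<in> paths E 1"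
      by blast
    then obtain e f where "e \<in> arcs E" "f \<in> arcs E" "\<mu> = (tail E e, [e])" "\<nu> = (tail E f, [f])"
      using paths_1D by metis
    then show "x \<in> {S e * star (S f) | e f. e \<in> arcs E \<and> f \<in> arcs E}"
      unfolding x by (auto simp: T_single)
  qed
  then show ?thesis by (simp only: core_level_def)
qed

lemma diag_level_1: "diag_level E P S 1 = cspan {S e * star (S e) | e. e \<in> arcs E}"
proof -
  have "{path_elem P S \<mu> * star (path_elem P S \<mu>) | \<mu>. \<mu> \<in> paths E 1}
      = {S e * star (S e) | e. e \<in> arcs E}"
  proof (intro Set.set_eqI iffI)
    fix x assume "x \<in> {S e * star (S e) | e. e \<in> arcs E}"
    then obtain e where "x = T (tail E e) [e] * star (T (tail E e) [e])" "e \<in> arcs E"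
      unfolding T_single by blast
    with paths_1I show "x \<in> {path_elem P S \<mu> * star (path_elem P S \<mu>) | \<mu>. \<mu> \<in> paths E 1}"
      by blast
  next
    fix x assume "x \<in> {path_elem P S \<mu> * star (path_elem P S \<mu>) | \<mu>. \<mu> \<in> paths E 1}"
    then obtain \<mu> where x: "x = path_elem P S \<mu> * star (path_elem P S \<mu>)" and "\<mu> \<in> paths E 1"
      by blast
    then obtain e where "e \<in> arcs E" "\<mu> = (tail E e, [e])"
      using paths_1D by metis
    then show "x \<in> {S e * star (S e) | e. e \<in> arcs E}"
      unfolding x by (auto simp: T_single)
  qed
  then show ?thesis by (simp only: diag_level_def)
qed

lemma diag_level_alt:
  "diag_level E P S k = cspan {T v p * star (T v p) | v p w. length p = k \<and> awalk v p w}"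
proof -
  have "{path_elem P S \<mu> * star (path_elem P S \<mu>) | \<mu>. \<mu> \<in> paths E k}
      = {T v p * star (T v p) | v p w. length p = k \<and> awalk v p w}"
    by (force simp: mem_paths_iff)
  then show ?thesis by (simp only: diag_level_def)
qed

lemma diag_level_base: "awalk v p w \<Longrightarrow> T v p * star (T v p) \<in> diag_level E P S (length p)"
  unfolding diag_level_alt by (rule complex_vector.span_base) blast

lemma csubspace_diag_level: "csubspace (diag_level E P S k)"
  unfolding diag_level_def by (rule complex_vector.subspace_span)

lemma diag_level_subset_core_level: "diag_level E P S k \<subseteq> core_level E P S k"
  unfolding diag_level_def core_level_def by (rule complex_vector.span_mono) auto

text \<open>The spanning elements are mutually orthogonal projections for paths of equal length, so
  a product of two of them is zero or one of them.\<close>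

lemma diag_level_star_mult:
  assumes "a \<in> diag_level E P S k" "b \<in> diag_level E P S k"
  shows "star a * b \<in> diag_level E P S k"
proof -
  note sp = csubspace_diag_level[of k]
  note sp' = complex_vector.subspace_0[OF sp] complex_vector.subspace_add[OF sp]
    complex_vector.subspace_scale[OF sp]
  from assms(1) show ?thesis
    unfolding diag_level_alt[of k]
  proof (induction rule: complex_vector.span_induct)
    case base
    show ?case unfolding diag_level_alt[symmetric]
      by (rule complex_vector.subspaceI)
        (auto simp: distrib_right star_add star_scaleC mult_scaleC_left intro: sp')
  next
    case (step a)
    then obtain v p w where a: "a = T v p * star (T v p)" "length p = k" "awalk v p w" by blast
    from assms(2) show ?case
      unfolding diag_level_alt[of k]
    proof (induction rule: complex_vector.span_induct)
      case base
      show ?case unfolding diag_level_alt[symmetric]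
        by (rule complex_vector.subspaceI)
          (auto simp: distrib_left mult_scaleC_right intro: sp')
    next
      case (step b)
      then obtain v' p' w' where b: "b = T v' p' * star (T v' p')" "length p' = k" "awalk v' p' w'"
        by blast
      have "star a * b = T v p * (star (T v p) * T v' p') * star (T v' p')"
        by (simp add: a b star_mult star_star mult.assoc)
      also have "\<dots> \<in> diag_level E P S k"
      proof (cases "v = v' \<and> p = p'")
        case True
        have "w \<in> verts E" using a by auto
        then show ?thesis
          using True a b diag_level_base[OF a(3)] by (simp add: star_T_T T_P)
      next
        case False
        then show ?thesis using a b sp' by (auto simp: star_T_T)
      qed
      finally show ?case unfolding diag_level_alt .
    qed
  qed
qed

text \<open>Each path projection is the sum of the projections of its one-edge extensions.\<close>

lemma diag_level_Suc: "diag_level E P S k \<subseteq> diag_level E P S (Suc k)"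
proof
  fix a assume "a \<in> diag_level E P S k"
  then show "a \<in> diag_level E P S (Suc k)"
    unfolding diag_level_alt[of k]
  proof (induction rule: complex_vector.span_induct)
    case base
    show ?case by (simp add: csubspace_diag_level)
  next
    case (step a)
    then obtain v p w where a: "a = T v p * star (T v p)" "length p = k" "awalk v p w" by blast
    have w: "w \<in> verts E" using a by auto
    have "a = T v p * P w * star (T v p)" using a w by (simp add: T_P)
    also have "\<dots> = (\<Sum>e\<in>out_arcs E w. T v p * S e * (star (S e) * star (T v p)))"
      by (simp add: P_eq_sum[OF w] sum_distrib_left sum_distrib_right mult.assoc)
    also have "\<dots> \<in> diag_level E P S (Suc k)"
    proof (rule complex_vector.subspace_sum[OF csubspace_diag_level])
      fix e assume "e \<in> out_arcs E w"
      then have aw: "awalk v (p @ [e]) (head E e)" by (rule awalk_snoc[OF a(3)])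
      show "T v p * S e * (star (S e) * star (T v p)) \<in> diag_level E P S (Suc k)"
        using diag_level_base[OF aw] a(2) by (simp add: T_snoc[OF aw] star_mult)
    qed
    finally show ?case .
  qed
qed

lemma diag_level_mono: "k \<le> l \<Longrightarrow> diag_level E P S k \<subseteq> diag_level E P S l"
  by (rule lift_Suc_mono_le) (rule diag_level_Suc)

lemma csubspace_Union_diag_level: "csubspace (\<Union>k. diag_level E P S k)"
proof (rule complex_vector.subspaceI)
  fix a b assume "a \<in> (\<Union>k. diag_level E P S k)" "b \<in> (\<Union>k. diag_level E P S k)"
  then obtain k l where "a \<in> diag_level E P S k" "b \<in> diag_level E P S l" by blast
  then have "a \<in> diag_level E P S (max k l)" "b \<in> diag_level E P S (max k l)"
    using diag_level_mono[of k "max k l"] diag_level_mono[of l "max k l"] by auto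
  then show "a + b \<in> (\<Union>k. diag_level E P S k)"
    using complex_vector.subspace_add[OF csubspace_diag_level] by blast
qed (auto intro: complex_vector.subspace_0[OF csubspace_diag_level]
    complex_vector.subspace_scale[OF csubspace_diag_level])

lemma csubspace_diag: "csubspace (diag E P S)"
  unfolding diag_def by (rule csubspace_closure[OF csubspace_Union_diag_level])

lemma diag_level_subset_diag: "diag_level E P S k \<subseteq> diag E P S"
  unfolding diag_def using closure_subset by fastforce

lemma diag_subset_core: "diag E P S \<subseteq> core E P S"
  unfolding diag_def core_def
  by (rule closure_mono) (use diag_level_subset_core_level in blast)

lemma diag_star_mult:
  assumes "a \<in> diag E P S" "b \<in> diag E P S"
  shows "star a * b \<in> diag E P S"
proof -
  let ?U = "\<Union>k. diag_level E P S k"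
  have U: "star x * y \<in> ?U" if "x \<in> ?U" "y \<in> ?U" for x y
  proof -
    from that obtain k l where "x \<in> diag_level E P S k" "y \<in> diag_level E P S l" by blast
    then have "x \<in> diag_level E P S (max k l)" "y \<in> diag_level E P S (max k l)"
      using diag_level_mono[of k "max k l"] diag_level_mono[of l "max k l"] by auto
    then show ?thesis using diag_level_star_mult by blast
  qed
  from assms obtain X Y where XY: "\<And>n::nat. X n \<in> ?U" "X \<longlonglongrightarrow> a" "\<And>n::nat. Y n \<in> ?U" "Y \<longlonglongrightarrow> b"
    unfolding diag_def closure_sequential by blast
  show ?thesis
    unfolding diag_def closure_sequential
  proof (intro exI[of _ "\<lambda>n. star (X n) * Y n"] conjI allI)
    show "star (X n) * Y n \<in> ?U" for n using XY by (intro U) auto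
    show "(\<lambda>n. star (X n) * Y n) \<longlonglongrightarrow> star a * b"
      using XY by (intro tendsto_mult tendsto_star) auto
  qed
qed

lemma core_level_1_star: "a \<in> core_level E P S 1 \<Longrightarrow> star a \<in> core_level E P S 1"
  unfolding core_level_1
proof (induction rule: complex_vector.span_induct)
  case base
  show ?case
    by (rule complex_vector.subspaceI) (auto simp: star_add star_scaleC
      intro: complex_vector.span_zero complex_vector.span_add complex_vector.span_scale)
next
  case (step x)
  then obtain e f where "star x = S f * star (S e)" "e \<in> arcs E" "f \<in> arcs E"
    by (auto simp: star_mult star_star)
  then show ?case by (auto intro!: complex_vector.span_base)
qed

lemma core_level_1_mult:
  assumes "a \<in> core_level E P S 1" "b \<in> core_level E P S 1"
  shows "a * b \<in> core_level E P S 1"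
proof -
  let ?G = "{S e * star (S f) | e f. e \<in> arcs E \<and> f \<in> arcs E}"
  from assms(1) show ?thesis
    unfolding core_level_1
  proof (induction rule: complex_vector.span_induct)
    case base
    show ?case
      by (rule complex_vector.subspaceI) (auto simp: distrib_right mult_scaleC_left
        intro: complex_vector.span_zero complex_vector.span_add complex_vector.span_scale)
  next
    case (step a)
    then obtain e f where a: "a = S e * star (S f)" "e \<in> arcs E" "f \<in> arcs E" by blast
    from assms(2) show ?case
      unfolding core_level_1
    proof (induction rule: complex_vector.span_induct)
      case base
      show ?case
        by (rule complex_vector.subspaceI) (auto simp: distrib_left mult_scaleC_right
          intro: complex_vector.span_zero complex_vector.span_add complex_vector.span_scale)
    next
      case (step b)
      then obtain g h where b: "b = S g * star (S h)" "g \<in> arcs E" "h \<in> arcs E" by blast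
      have "a * b = S e * (star (S f) * S g) * star (S h)" by (simp add: a b mult.assoc)
      \<comment> \<open>For \<open>f = g\<close> the middle factor is \<open>P (head E f)\<close>,
        which \<open>S e\<close> absorbs only if the heads of \<open>e\<close> and \<open>f\<close>
        agree.\<close>
      also have "\<dots> = (if f = g \<and> head E e = head E f then S e * star (S h) else 0)"
        using a b by (auto simp: S_star_S S_P)
      also have "\<dots> \<in> cspan ?G"
        using a b by (auto intro: complex_vector.span_zero complex_vector.span_base)
      finally show ?case .
    qed
  qed
qed

text \<open>This produces the matrix entries of \<open>a\<close>. The product of the two vertex
  projections treats equal and different heads at once, being zero in the second case.\<close>

lemma core_level_1_compress:
  assumes "a \<in> core_level E P S 1" "e \<in> arcs E" "f \<in> arcs E"
  shows "\<exists>c. star (S e) * a * S f = c *\<^sub>C (P (head E e) * P (head E f))"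
  using assms(1) unfolding core_level_1
proof (induction rule: complex_vector.span_induct)
  case base
  show ?case
  proof (rule complex_vector.subspaceI; safe)
    show "\<exists>c. star (S e) * 0 * S f = c *\<^sub>C (P (head E e) * P (head E f))"
      by (rule exI[of _ 0]) (simp add: scaleC_simps)
  next
    fix x y b c
    assume "star (S e) * x * S f = b *\<^sub>C (P (head E e) * P (head E f))"
      "star (S e) * y * S f = c *\<^sub>C (P (head E e) * P (head E f))"
    then show "\<exists>c. star (S e) * (x + y) * S f = c *\<^sub>C (P (head E e) * P (head E f))"
      by (intro exI[of _ "b + c"]) (simp add: distrib_left distrib_right scaleC_add_left)
  next
    fix x b c
    assume "star (S e) * x * S f = b *\<^sub>C (P (head E e) * P (head E f))"
    then show "\<exists>b. star (S e) * (c *\<^sub>C x) * S f = b *\<^sub>C (P (head E e) * P (head E f))"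
      by (intro exI[of _ "c * b"]) (simp add: mult_scaleC_left mult_scaleC_right scaleC_scaleC)
  qed
next
  case (step x)
  then obtain g h where x: "x = S g * star (S h)" "g \<in> arcs E" "h \<in> arcs E" by blast
  have "star (S e) * x * S f = (star (S e) * S g) * (star (S h) * S f)"
    by (simp add: x mult.assoc)
  also have "\<dots> = (if e = g \<and> h = f then 1 else 0) *\<^sub>C (P (head E e) * P (head E f))"
    using assms x by (auto simp: S_star_S scaleC_simps)
  finally show ?case by blast
qed

text \<open>In the tensor picture \<open>a\<close> acts on the first edge and
  \<open>\<phi> b\<close> on what follows. Concretely, both products of
  \<open>S e * star (S f)\<close> with \<open>\<phi> b\<close> equal
  \<open>S e * b * star (S f)\<close>.\<close>

lemma core_level_1_shift_comm:
  assumes "a \<in> core_level E P S 1" "vertex_comm b"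
  shows "a * \<phi> b = \<phi> b * a"
  using assms(1) unfolding core_level_1
proof (induction rule: complex_vector.span_induct)
  case base
  show ?case
    by (rule complex_vector.subspaceI)
      (auto simp: distrib_left distrib_right mult_scaleC_left mult_scaleC_right)
next
  case (step x)
  then obtain e f where x: "x = S e * star (S f)" "e \<in> arcs E" "f \<in> arcs E" by blast
  have "star (\<phi> (star b) * S f) = star (S f * star b)"
    using x shift_vertex_comm_S[of "star b" f] vertex_comm_star[OF assms(2)] by simp
  then have "star (S f) * \<phi> b = b * star (S f)"
    by (simp add: star_mult star_star shift_star)
  then have "x * \<phi> b = S e * b * star (S f)" by (simp add: x mult.assoc)
  also have "\<dots> = \<phi> b * x"
    using shift_vertex_comm_S[OF assms(2) x(2)] by (simp add: x mult.assoc[symmetric])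
  finally show ?case .
qed

lemma diag_level_1_vertex_comm:
  assumes "a \<in> diag_level E P S 1"
  shows "vertex_comm a"
  using assms unfolding diag_level_1
proof (induction rule: complex_vector.span_induct)
  case base
  show ?case
    by (rule complex_vector.subspaceI) (auto simp: vertex_comm_def
      distrib_left distrib_right mult_scaleC_left mult_scaleC_right)
next
  case (step x)
  then show ?case
    by (auto simp: vertex_comm_def mult.assoc star_S_P P_S_mult)
qed

lemma diag_level_1_mult_S:
  assumes "a \<in> diag_level E P S 1" "e \<in> arcs E"
  shows "\<exists>c. a * S e = c *\<^sub>C S e"
  using assms(1) unfolding diag_level_1
proof (induction rule: complex_vector.span_induct)
  case base
  show ?case
  proof (rule complex_vector.subspaceI; safe)
    show "\<exists>c. 0 * S e = c *\<^sub>C S e" by (rule exI[of _ 0]) (simp add: scaleC_simps)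
  next
    fix x y b c assume "x * S e = b *\<^sub>C S e" "y * S e = c *\<^sub>C S e"
    then show "\<exists>c. (x + y) * S e = c *\<^sub>C S e"
      by (intro exI[of _ "b + c"]) (simp add: distrib_right scaleC_add_left)
  next
    fix x b c assume "x * S e = b *\<^sub>C S e"
    then show "\<exists>b. (c *\<^sub>C x) * S e = b *\<^sub>C S e"
      by (intro exI[of _ "c * b"]) (simp add: mult_scaleC_left scaleC_scaleC)
  qed
next
  case (step x)
  then obtain f where x: "x = S f * star (S f)" "f \<in> arcs E" by blast
  have "x * S e = (if f = e then 1 else 0) *\<^sub>C S e"
    using x assms by (auto simp: mult.assoc S_star_S S_P scaleC_simps)
  then show ?case by blast
qed

lemma S_diag_level_star_S:
  assumes "a \<in> diag_level E P S n" "e \<in> arcs E"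
  shows "S e * a * star (S e) \<in> diag_level E P S (Suc n)"
  using assms(1) unfolding diag_level_alt[of n]
proof (induction rule: complex_vector.span_induct)
  case base
  note sp = csubspace_diag_level[of "Suc n"]
  show ?case
    by (rule complex_vector.subspaceI)
      (auto simp: distrib_left distrib_right mult_scaleC_left mult_scaleC_right
        intro: complex_vector.subspace_0[OF sp] complex_vector.subspace_add[OF sp]
          complex_vector.subspace_scale[OF sp])
next
  case (step x)
  then obtain v p w where x: "x = T v p * star (T v p)" "length p = n" "awalk v p w" by blast
  have v: "v \<in> verts E" using x by auto
  show ?case
  proof (cases "v = head E e")
    case True
    then have aw: "awalk (tail E e) (e # p) w" using x assms by (simp add: awalk_Cons_iff)
    show ?thesis
      using diag_level_base[OF aw] x(1,2) True by (simp add: T_Cons[OF aw] star_mult mult.assoc)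
  next
    case False
    have "S e * T v p = S e * (P v * T v p)" using x v by (simp add: P_T)
    also have "\<dots> = 0" using False assms(2) v by (simp add: mult.assoc[symmetric] S_P)
    finally show ?thesis
      using complex_vector.subspace_0[OF csubspace_diag_level]
      by (simp add: x mult.assoc[symmetric])
  qed
qed

text \<open>By the recursion the next product is a sum of terms
  \<open>a * S e * x * star (S e)\<close> with \<open>x\<close> the shorter product. Each
  \<open>a * S e\<close> is a multiple of \<open>S e\<close>, so the level rises by exactly
  one.\<close>

lemma shift_prod_diag_level:
  assumes "a \<in> diag_level E P S 1"
  shows "shift_prod E S a n \<in> diag_level E P S n"
proof (induction n)
  case 0
  have "P v \<in> diag_level E P S 0" if "v \<in> verts E" for v
    using diag_level_base[of v "[]" v] that by (simp add: awalk_Nil_iff P_star P_idem)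
  then show ?case
    unfolding shift_prod_0 sum_P[symmetric]
    by (intro complex_vector.subspace_sum csubspace_diag_level)
next
  case (Suc n)
  have "shift_prod E S a (Suc n) = (\<Sum>e\<in>arcs E. a * S e * shift_prod E S a n * star (S e))"
    by (simp add: shift_prod_Suc[OF diag_level_1_vertex_comm[OF assms]] shift_def sum_distrib_left
      mult.assoc)
  also have "\<dots> \<in> diag_level E P S (Suc n)"
  proof (rule complex_vector.subspace_sum[OF csubspace_diag_level])
    fix e assume e: "e \<in> arcs E"
    obtain c where c: "a * S e = c *\<^sub>C S e" using diag_level_1_mult_S[OF assms e] by blast
    show "a * S e * shift_prod E S a n * star (S e) \<in> diag_level E P S (Suc n)"
      unfolding c mult_scaleC_left
      by (intro complex_vector.subspace_scale csubspace_diag_level S_diag_level_star_S Suc.IH e)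
  qed
  finally show ?case .
qed

end

section \<open>Weighted path counts and the 2-norm\<close>

text \<open>This is the \<open>n\<close>-th power of the \<open>w\<close>-weighted adjacency matrix
  applied to \<open>\<xi>\<close> and divided by the \<open>n\<close>-th power of
  \<open>\<beta>\<close>: the sum over walks of length \<open>n\<close> from \<open>v\<close> of the
  product of the weights times \<open>\<xi>\<close> at the end.\<close>

primrec weighted_walks ::
    "('v, 'e) pre_digraph \<Rightarrow> ('e \<Rightarrow> real) \<Rightarrow> real \<Rightarrow> ('v \<Rightarrow> real) \<Rightarrow> nat \<Rightarrow> 'v \<Rightarrow> real"
  where
    "weighted_walks E w \<beta> \<xi> 0 v = \<xi> v"
  | "weighted_walks E w \<beta> \<xi> (Suc n) v
      = (\<Sum>e\<in>out_arcs E v. w e * weighted_walks E w \<beta> \<xi> n (head E e)) / \<beta>"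

lemma (in fin_digraph) adjacency_eigenvector_sum:
  fixes \<xi> :: "'a \<Rightarrow> real"
  assumes "adjacency_eigenvector G \<beta> \<xi>" "v \<in> verts G"
  shows "(\<Sum>e\<in>out_arcs G v. \<xi> (head G e)) = \<beta> * \<xi> v"
proof -
  have "(\<Sum>e\<in>out_arcs G v. \<xi> (head G e))
      = (\<Sum>w\<in>verts G. \<Sum>e\<in>{e \<in> out_arcs G v. head G e = w}. \<xi> (head G e))"
    by (rule sum.group[symmetric]) auto
  also have "\<dots> = (\<Sum>w\<in>verts G. of_nat (adjacency G v w) * \<xi> w)"
    by (intro sum.cong refl) (simp add: adjacency_def conj_assoc)
  also have "\<dots> = \<beta> * \<xi> v" using assms by (simp add: adjacency_eigenvector_def)
  finally show ?thesis .
qed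

text \<open>
  The weighted counts decrease in \<open>n\<close>. One edge of weight below 1 makes them drop strictly, after
  boundedly many steps at every vertex, so their limit \<open>l\<close> satisfies \<open>l \<le> c l\<close> with \<open>c < 1\<close>.
\<close>

lemma (in fin_digraph) weighted_walks_tendsto_0:
  fixes \<xi> :: "'a \<Rightarrow> real"
  assumes trans: "transitive_graph G" and \<beta>: "\<beta> > 0"
    and pos: "\<And>v. v \<in> verts G \<Longrightarrow> \<xi> v > 0" and ev: "adjacency_eigenvector G \<beta> \<xi>"
    and w: "\<And>e. e \<in> arcs G \<Longrightarrow> 0 \<le> w e \<and> w e \<le> 1"
    and e0: "e0 \<in> arcs G" "w e0 < 1" and v: "v \<in> verts G"
  shows "(\<lambda>n. weighted_walks G w \<beta> \<xi> n v) \<longlonglongrightarrow> 0"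
proof -
  let ?h = "weighted_walks G w \<beta> \<xi>"
  \<comment> \<open>With all weights equal to 1 the recursion would leave \<open>\<xi>\<close>
    unchanged; this is the comparison used below.\<close>
  have fixed: "(\<Sum>e\<in>out_arcs G v. \<xi> (head G e)) / \<beta> = \<xi> v" if "v \<in> verts G" for v
    using adjacency_eigenvector_sum[OF ev that] \<beta> by simp
  have nonneg: "0 \<le> ?h n v" if "v \<in> verts G" for n v
    using that
  proof (induction n arbitrary: v)
    case (Suc n)
    then show ?case using \<beta> w by (auto intro!: divide_nonneg_pos sum_nonneg mult_nonneg_nonneg)
  qed (use pos in force)
  have step: "?h (Suc n) v \<le> ?h n v" if "v \<in> verts G" for n v
    using that
  proof (induction n arbitrary: v)
    case 0
    have "(\<Sum>e\<in>out_arcs G v. w e * \<xi> (head G e)) \<le> (\<Sum>e\<in>out_arcs G v. \<xi> (head G e))"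
      using w pos by (intro sum_mono mult_left_le_one_le) (auto intro: less_imp_le)
    then have "(\<Sum>e\<in>out_arcs G v. w e * \<xi> (head G e)) / \<beta> \<le> (\<Sum>e\<in>out_arcs G v. \<xi> (head G e)) / \<beta>"
      using \<beta> by (intro divide_right_mono) auto
    then show ?case using fixed[OF 0] by simp
  next
    case (Suc n)
    have "(\<Sum>e\<in>out_arcs G v. w e * ?h (Suc n) (head G e)) \<le> (\<Sum>e\<in>out_arcs G v. w e * ?h n (head G e))"
      using w by (intro sum_mono mult_left_mono Suc.IH) auto
    then show ?case
      unfolding weighted_walks.simps(2)[of _ _ _ _ "Suc n"] weighted_walks.simps(2)[of _ _ _ _ n v]
      using \<beta> by (intro divide_right_mono) auto
  qed
  have dec: "decseq (\<lambda>n. ?h n v)" if "v \<in> verts G" for v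
    using step that by (intro decseq_SucI) auto
  have le: "?h n v \<le> \<xi> v" if "v \<in> verts G" for n v
    using decseqD[OF dec[OF that], of 0 n] by simp
  \<comment> \<open>A strict drop starts at the tail of an edge of weight below 1 and propagates
    backwards along every edge, with one more step of the recursion each time.\<close>
  have strict: "?h (Suc n) v < \<xi> v"
    if "e \<in> arcs G" "tail G e = v" "w e < 1 \<or> ?h n (head G e) < \<xi> (head G e)" for e n v
  proof -
    have "(\<Sum>e\<in>out_arcs G v. w e * ?h n (head G e)) < (\<Sum>e\<in>out_arcs G v. \<xi> (head G e))"
    proof (rule sum_strict_mono_ex1)
      have bound: "w f * ?h n (head G f) \<le> ?h n (head G f)" if "f \<in> arcs G" for f
        using w[OF that] nonneg that by (intro mult_left_le_one_le) auto
      show "\<forall>f\<in>out_arcs G v. w f * ?h n (head G f) \<le> \<xi> (head G f)"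
      proof
        fix f assume "f \<in> out_arcs G v"
        then have "f \<in> arcs G" "head G f \<in> verts G" by auto
        then show "w f * ?h n (head G f) \<le> \<xi> (head G f)"
          using bound[of f] le[of "head G f" n] by linarith
      qed
      have "w e * ?h n (head G e) < \<xi> (head G e)"
      proof (cases "?h n (head G e) < \<xi> (head G e)")
        case True
        then show ?thesis using bound[OF that(1)] by simp
      next
        case False
        then have "?h n (head G e) = \<xi> (head G e)" "w e < 1" using that le[of "head G e" n] by auto
        then show ?thesis using pos[of "head G e"] that by simp
      qed
      then show "\<exists>f\<in>out_arcs G v. w f * ?h n (head G f) < \<xi> (head G f)"
        using that by auto
    qed (rule finite_out_arcs)
    then have "?h (Suc n) v < (\<Sum>e\<in>out_arcs G v. \<xi> (head G e)) / \<beta>"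
      using \<beta> by (simp add: divide_strict_right_mono)
    then show ?thesis using fixed[of v] that by auto
  qed
  have "\<exists>n. ?h n v < \<xi> v" if v: "v \<in> verts G" for v
  proof -
    obtain p where p: "awalk v p (tail G e0)"
      using trans v tail_in_verts[OF e0(1)] unfolding transitive_graph_def by blast
    then show ?thesis
    proof (induction p arbitrary: v)
      case Nil
      then have "tail G e0 = v" by (simp add: awalk_Nil_iff)
      then show ?case using strict[of e0 v 0] e0 by blast
    next
      case (Cons e p)
      then have e: "e \<in> arcs G" "tail G e = v" "awalk (head G e) p (tail G e0)"
        by (auto simp: awalk_Cons_iff)
      with Cons.IH obtain n where "?h n (head G e) < \<xi> (head G e)" by blast
      with strict[OF e(1,2), of n] show ?case by blast
    qed
  qed
  then obtain m where m: "\<And>v. v \<in> verts G \<Longrightarrow> ?h (m v) v < \<xi> v" by metis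
  \<comment> \<open>Since the counts decrease in \<open>n\<close>, the largest of the finitely many
    waiting times works at all vertices.\<close>
  define N where "N = Max (m ` verts G)"
  have N: "?h N v < \<xi> v" if "v \<in> verts G" for v
  proof -
    have "m v \<le> N" unfolding N_def using that by simp
    then show ?thesis using decseqD[OF dec[OF that]] m[OF that] by (meson order_le_less_trans)
  qed
  define c where "c = Max ((\<lambda>v. ?h N v / \<xi> v) ` verts G)"
  have ne: "verts G \<noteq> {}" using v by auto
  have c1: "c < 1" unfolding c_def
    using ne N pos by (subst Max_less_iff) (auto simp: divide_less_eq_1_pos)
  have hc: "?h N v \<le> c * \<xi> v" if "v \<in> verts G" for v
  proof -
    have "?h N v / \<xi> v \<le> c" unfolding c_def using that by simp
    then show ?thesis using pos[OF that] by (simp add: pos_divide_le_eq)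
  qed
  \<comment> \<open>The comparison of \<open>?h N\<close> with \<open>c * \<xi>\<close> is carried
    along by the recursion, which is linear and monotone because the weights are
    nonnegative.\<close>
  have contract: "?h (k + N) v \<le> c * ?h k v" if "v \<in> verts G" for k v
    using that
  proof (induction k arbitrary: v)
    case 0
    then show ?case using hc by simp
  next
    case (Suc k)
    have "(\<Sum>e\<in>out_arcs G v. w e * ?h (k + N) (head G e))
        \<le> (\<Sum>e\<in>out_arcs G v. w e * (c * ?h k (head G e)))"
      using w by (intro sum_mono mult_left_mono Suc.IH) auto
    also have "\<dots> = c * (\<Sum>e\<in>out_arcs G v. w e * ?h k (head G e))"
      by (simp add: sum_distrib_left mult.left_commute)
    finally show ?case using \<beta> by (simp add: divide_right_mono)
  qed
  obtain l where l: "(\<lambda>n. ?h n v) \<longlonglongrightarrow> l"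
    using decseq_convergent[OF dec[OF v], of 0] nonneg[OF v] by blast
  have "l \<le> c * l"
  proof (rule LIMSEQ_le)
    show "(\<lambda>k. ?h (k + N) v) \<longlonglongrightarrow> l" using l by (rule LIMSEQ_ignore_initial_segment)
    show "(\<lambda>k. c * ?h k v) \<longlonglongrightarrow> c * l" using l by (intro tendsto_mult_left)
  qed (use contract v in auto)
  moreover have "0 \<le> l" using l nonneg[OF v] by (intro LIMSEQ_le_const) auto
  ultimately have "l = 0" using c1 by (smt (verit) mult_right_mono mult_less_cancel_right2)
  then show ?thesis using l by simp
qed

locale graph_cstar_state = graph_cstar E P S
  for E :: "('v, 'e) pre_digraph" and P :: "'v \<Rightarrow> 'a::cstar_algebra" and S :: "'e \<Rightarrow> 'a" +
  fixes \<Phi> :: "'a \<Rightarrow> 'a" and \<tau> :: "'a \<Rightarrow> complex" and \<beta> :: real and \<xi> :: "'v \<Rightarrow> real"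
  assumes cond_exp: "faithful_conditional_expectation \<Phi> (diag E P S)"
    and cond_exp_off_diag:
      "\<And>\<mu> \<nu>. \<mu> \<in> (\<Union>k. paths E k) \<Longrightarrow> \<nu> \<in> (\<Union>k. paths E k) \<Longrightarrow> \<mu> \<noteq> \<nu> \<Longrightarrow>
           \<Phi> (path_elem P S \<mu> * star (path_elem P S \<nu>)) = 0"
    and \<beta>_pos: "\<beta> > 0"
    and \<xi>_pos: "\<And>v. v \<in> verts E \<Longrightarrow> \<xi> v > 0" and eigenvector: "adjacency_eigenvector E \<beta> \<xi>"
    and trace: "tracial_state_on (core E P S) \<tau>"
    and trace_path:
      "\<And>k \<mu> \<nu>. \<mu> \<in> paths E k \<Longrightarrow> \<nu> \<in> paths E k \<Longrightarrow> path_range E \<mu> = path_range E \<nu> \<Longrightarrow>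
         \<tau> (path_elem P S \<mu> * star (path_elem P S \<nu>)) =
           (if \<mu> = \<nu> then of_real (\<xi> (path_range E \<mu>) / ((\<Sum>v\<in>verts E. \<xi> v) * \<beta> ^ k)) else 0)"
begin

section \<open>The trace seminorm on the diagonal\<close>

sublocale cond_exp: Vector_Spaces.linear scaleC scaleC \<Phi>
  using cond_exp by (simp add: faithful_conditional_expectation_def)

lemma cond_exp_diag: "\<Phi> a \<in> diag E P S"
  and cond_exp_fix: "a \<in> diag E P S \<Longrightarrow> \<Phi> a = a"
  and cond_exp_bimodule: "a \<in> diag E P S \<Longrightarrow> b \<in> diag E P S \<Longrightarrow> \<Phi> (a * x * b) = a * \<Phi> x * b"
  and norm_cond_exp: "norm (\<Phi> x) \<le> norm x"
  using cond_exp by (auto simp: faithful_conditional_expectation_def)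

lemma trace_add: "a \<in> diag E P S \<Longrightarrow> b \<in> diag E P S \<Longrightarrow> \<tau> (a + b) = \<tau> a + \<tau> b"
  and trace_scaleC: "a \<in> diag E P S \<Longrightarrow> \<tau> (c *\<^sub>C a) = c * \<tau> a"
  and trace_pos: "a \<in> diag E P S \<Longrightarrow> \<tau> (star a * a) \<in> \<real>\<^sub>\<ge>\<^sub>0"
  and trace_bound: "a \<in> diag E P S \<Longrightarrow> cmod (\<tau> a) \<le> norm a"
  and trace_one: "\<tau> 1 = 1"
  using trace diag_subset_core by (auto simp: tracial_state_on_def subset_iff)

lemma diag_0: "0 \<in> diag E P S"
  and diag_add: "a \<in> diag E P S \<Longrightarrow> b \<in> diag E P S \<Longrightarrow> a + b \<in> diag E P S"
  and diag_diff: "a \<in> diag E P S \<Longrightarrow> b \<in> diag E P S \<Longrightarrow> a - b \<in> diag E P S"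
  and diag_scaleC: "a \<in> diag E P S \<Longrightarrow> c *\<^sub>C a \<in> diag E P S"
  by (rule complex_vector.subspace_0 complex_vector.subspace_add complex_vector.subspace_diff
    complex_vector.subspace_scale, rule csubspace_diag, assumption?, assumption?)+

lemma diag_sum: "(\<And>i. i \<in> I \<Longrightarrow> f i \<in> diag E P S) \<Longrightarrow> sum f I \<in> diag E P S"
  by (rule complex_vector.subspace_sum[OF csubspace_diag])

lemma trace_0: "\<tau> 0 = 0"
  using trace_scaleC[OF diag_0, of 0] by (simp add: scaleC_simps)

lemma trace_sum: "(\<And>i. i \<in> I \<Longrightarrow> f i \<in> diag E P S) \<Longrightarrow> \<tau> (sum f I) = (\<Sum>i\<in>I. \<tau> (f i))"
  by (induction I rule: infinite_finite_induct) (auto simp: trace_0 trace_add diag_sum)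

text \<open>This is the square of \<open>norm2\<close>. It is additive over orthogonal sums, and the
  root is taken only at the very end.\<close>

definition sqnorm :: "'a \<Rightarrow> real"
  where "sqnorm a = Re (\<tau> (star a * a))"

lemma sqnorm_nonneg: "a \<in> diag E P S \<Longrightarrow> 0 \<le> sqnorm a"
  using trace_pos[of a] by (simp add: sqnorm_def complex_nonneg_Reals_iff)

lemma sqnorm_le: "a \<in> diag E P S \<Longrightarrow> sqnorm a \<le> (norm a)\<^sup>2"
  using trace_bound[OF diag_star_mult, of a a] abs_Re_le_cmod[of "\<tau> (star a * a)"]
  by (simp add: sqnorm_def cstar_identity)

lemma sqnorm_scaleC: "a \<in> diag E P S \<Longrightarrow> sqnorm (c *\<^sub>C a) = (cmod c)\<^sup>2 * sqnorm a"
proof -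
  assume "a \<in> diag E P S"
  then have "\<tau> (star (c *\<^sub>C a) * (c *\<^sub>C a)) = (cnj c * c) * \<tau> (star a * a)"
    by (simp add: star_scaleC mult_scaleC_left mult_scaleC_right scaleC_scaleC trace_scaleC
      diag_star_mult mult.commute)
  also have "cnj c * c = complex_of_real ((cmod c)\<^sup>2)"
    by (simp only: complex_norm_square mult.commute)
  finally show ?thesis by (simp add: sqnorm_def)
qed

text \<open>
  The parallelogram law replaces the triangle inequality, which would need the Cauchy--Schwarz
  inequality for \<open>\<tau>\<close>.
\<close>

lemma sqnorm_add_le:
  assumes "a \<in> diag E P S" "b \<in> diag E P S"
  shows "sqnorm (a + b) \<le> 2 * sqnorm a + 2 * sqnorm b"
proof -
  note [intro] = diag_star_mult diag_add diag_diff assms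
  have "star (a + b) * (a + b) + star (a - b) * (a - b)
      = star a * a + star a * a + (star b * b + star b * b)"
    by (simp add: star_add star_diff algebra_simps)
  moreover have "\<tau> (star (a + b) * (a + b) + star (a - b) * (a - b))
      = \<tau> (star (a + b) * (a + b)) + \<tau> (star (a - b) * (a - b))"
    by (rule trace_add) auto
  moreover have "\<tau> (star a * a + star a * a + (star b * b + star b * b))
      = \<tau> (star a * a) + \<tau> (star a * a) + (\<tau> (star b * b) + \<tau> (star b * b))"
    by (subst trace_add; (subst trace_add)?) (auto simp: trace_add diag_star_mult assms)
  ultimately have "\<tau> (star (a + b) * (a + b)) + \<tau> (star (a - b) * (a - b))
      = \<tau> (star a * a) + \<tau> (star a * a) + (\<tau> (star b * b) + \<tau> (star b * b))"
    by (simp only:)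
  from arg_cong[OF this, of Re]
  have "sqnorm (a + b) + sqnorm (a - b) = 2 * sqnorm a + 2 * sqnorm b"
    by (simp add: sqnorm_def)
  moreover have "0 \<le> sqnorm (a - b)" by (rule sqnorm_nonneg) auto
  ultimately show ?thesis by simp
qed

lemma sqnorm_orthogonal_sum:
  assumes "\<And>i. i \<in> I \<Longrightarrow> f i \<in> diag E P S"
    and orth: "\<And>i j. i \<in> I \<Longrightarrow> j \<in> I \<Longrightarrow> i \<noteq> j \<Longrightarrow> star (f i) * f j = 0" and fin: "finite I"
  shows "sqnorm (sum f I) = (\<Sum>i\<in>I. sqnorm (f i))"
proof -
  have "star (sum f I) * sum f I = (\<Sum>i\<in>I. \<Sum>j\<in>I. star (f i) * f j)"
    by (simp add: star_sum sum_product)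
  also have "\<dots> = (\<Sum>i\<in>I. \<Sum>j\<in>I. if i = j then star (f i) * f i else 0)"
    by (intro sum.cong refl) (auto simp: orth)
  also have "\<dots> = (\<Sum>i\<in>I. star (f i) * f i)" using fin by simp
  finally show ?thesis
    by (simp add: sqnorm_def trace_sum diag_star_mult assms(1) Re_sum)
qed

definition vanishing :: "(nat \<Rightarrow> 'a) \<Rightarrow> bool"
  where "vanishing X \<longleftrightarrow> (\<lambda>n. sqnorm (\<Phi> (X n))) \<longlonglongrightarrow> 0"

lemma vanishing_zero: "vanishing (\<lambda>n. 0)"
  by (simp add: vanishing_def sqnorm_def trace_0)

lemma vanishing_scaleC: "vanishing X \<Longrightarrow> vanishing (\<lambda>n. c *\<^sub>C X n)"
  unfolding vanishing_def
  using tendsto_mult_left[of "\<lambda>n. sqnorm (\<Phi> (X n))" 0 sequentially "(cmod c)\<^sup>2"]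
  by (simp add: cond_exp.scale sqnorm_scaleC cond_exp_diag)

lemma vanishing_offset: "vanishing (\<lambda>n. X (n + k)) \<Longrightarrow> vanishing X"
  unfolding vanishing_def by (rule LIMSEQ_offset)

lemma vanishing_add:
  assumes "vanishing X" "vanishing Y"
  shows "vanishing (\<lambda>n. X n + Y n)"
  unfolding vanishing_def
proof (rule tendsto_sandwich)
  show "\<forall>\<^sub>F n in sequentially. 0 \<le> sqnorm (\<Phi> (X n + Y n))"
    by (simp add: sqnorm_nonneg cond_exp_diag)
  show "\<forall>\<^sub>F n in sequentially. sqnorm (\<Phi> (X n + Y n)) \<le> 2 * sqnorm (\<Phi> (X n)) + 2 * sqnorm (\<Phi> (Y n))"
    by (simp add: cond_exp.add sqnorm_add_le cond_exp_diag)
  show "(\<lambda>n. 2 * sqnorm (\<Phi> (X n)) + 2 * sqnorm (\<Phi> (Y n))) \<longlonglongrightarrow> 0"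
    using assms unfolding vanishing_def by (auto intro!: tendsto_eq_intros)
qed auto

text \<open>The approximation is in norm and uniform in \<open>n\<close>; it survives
  \<open>\<Phi>\<close>, which is contractive, and \<open>sqnorm\<close>, which the squared norm
  dominates.\<close>

lemma vanishing_approx:
  assumes "\<And>\<epsilon>. \<epsilon> > 0 \<Longrightarrow> \<exists>Y. vanishing Y \<and> (\<forall>n. norm (X n - Y n) \<le> \<epsilon>)"
  shows "vanishing X"
  unfolding vanishing_def
proof (rule LIMSEQ_I)
  fix r :: real assume r: "r > 0"
  \<comment> \<open>Both terms of the parallelogram bound carry a factor 2, so each square may
    contribute a quarter of \<open>r\<close>.\<close>
  define \<epsilon> where "\<epsilon> = sqrt (r / 4)"
  have \<epsilon>: "\<epsilon> > 0" "\<epsilon>\<^sup>2 = r / 4" using r by (simp_all add: \<epsilon>_def)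
  obtain Y where Y: "vanishing Y" "\<And>n. norm (X n - Y n) \<le> \<epsilon>" using assms[OF \<epsilon>(1)] by blast
  obtain N where N: "\<And>n. n \<ge> N \<Longrightarrow> norm (sqnorm (\<Phi> (Y n)) - 0) < r / 4"
    using LIMSEQ_D[OF Y(1)[unfolded vanishing_def], of "r / 4"] r by auto
  show "\<exists>N. \<forall>n\<ge>N. norm (sqnorm (\<Phi> (X n)) - 0) < r"
  proof (intro exI allI impI)
    fix n assume "N \<le> n"
    have "norm (\<Phi> (X n - Y n)) \<le> \<epsilon>" using norm_cond_exp Y(2) order_trans by blast
    then have "sqnorm (\<Phi> (X n - Y n)) \<le> \<epsilon>\<^sup>2"
      by (meson cond_exp_diag norm_ge_zero order_trans power_mono sqnorm_le)
    moreover have "sqnorm (\<Phi> (Y n)) < r / 4" using N[OF \<open>N \<le> n\<close>] by auto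
    moreover have "sqnorm (\<Phi> (X n)) \<le> 2 * sqnorm (\<Phi> (Y n)) + 2 * sqnorm (\<Phi> (X n - Y n))"
      using sqnorm_add_le[OF cond_exp_diag cond_exp_diag, of "Y n" "X n - Y n"]
      by (simp flip: cond_exp.add)
    moreover have "0 \<le> sqnorm (\<Phi> (X n))" by (simp add: sqnorm_nonneg cond_exp_diag)
    ultimately show "norm (sqnorm (\<Phi> (X n)) - 0) < r" using \<epsilon> by simp
  qed
qed

lemma trace_T:
  assumes "awalk v p w"
  shows "\<tau> (T v p * star (T v p)) = of_real (\<xi> w / ((\<Sum>v\<in>verts E. \<xi> v) * \<beta> ^ length p))"
  using trace_path[of "(v, p)" "length p" "(v, p)"] assms
  by (auto simp: mem_paths_iff path_range_eq)

text \<open>The trace of \<open>P v\<close> is a positive multiple of \<open>\<xi> v\<close>. Hence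
  a scalar multiple of \<open>P v\<close> determines its scalar.\<close>

lemma P_nonzero:
  assumes "v \<in> verts E"
  shows "P v \<noteq> 0"
proof
  assume "P v = 0"
  then have "complex_of_real (\<xi> v / (\<Sum>v\<in>verts E. \<xi> v)) = 0"
    using trace_T[of v "[]" v] assms by (simp add: awalk_Nil_iff trace_0)
  then have "\<xi> v / (\<Sum>v\<in>verts E. \<xi> v) = 0" by (simp only: of_real_eq_0_iff)
  moreover have "0 < (\<Sum>v\<in>verts E. \<xi> v)" using assms by (intro sum_pos \<xi>_pos) auto
  ultimately show False using \<xi>_pos[OF assms] by auto
qed

lemma diag_T: "awalk v p w \<Longrightarrow> T v p * star (T v p) \<in> diag E P S"
  using diag_level_base diag_level_subset_diag by blast

text \<open>By the bimodule property each value of \<open>\<Phi>\<close> lies in the corner cut out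
  by its path projection, and corners of distinct paths of equal length are orthogonal.\<close>

lemma cond_exp_local:
  assumes "awalk v p w" "awalk v p' w'"  and "p \<noteq> p'" "length p = length p'"
  shows "star (\<Phi> (T v p * x * star (T v p))) * \<Phi> (T v p' * y * star (T v p')) = 0"
proof -
  have loc: "\<Phi> (T v p * x * star (T v p))
      = T v p * star (T v p) * \<Phi> (T v p * x * star (T v p)) * (T v p * star (T v p))"
    if "awalk v p w" for p w x
  proof -
    have star: "star (T v p) * (T v p * star (T v p)) = star (T v p)"
      using arg_cong[OF T_partial_isometry[OF that], of star] by (simp add: star_mult star_star mult.assoc)
    have "T v p * x * star (T v p)
        = (T v p * star (T v p)) * (T v p * x * star (T v p)) * (T v p * star (T v p))"
      using T_partial_isometry[OF that] star by (simp add: mult.assoc) (simp add: mult.assoc[symmetric])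
    then show ?thesis
      using cond_exp_bimodule[OF diag_T[OF that] diag_T[OF that], of "T v p * x * star (T v p)"] by simp
  qed
  let ?a = "\<Phi> (T v p * x * star (T v p))" and ?b = "\<Phi> (T v p' * y * star (T v p'))"
  have "star ?a = star (T v p * star (T v p) * ?a * (T v p * star (T v p)))"
    using loc[OF assms(1)] by (rule arg_cong)
  also have "\<dots> = T v p * star (T v p) * star ?a * T v p * star (T v p)"
    by (simp add: star_mult star_star mult.assoc)
  finally have a: "star ?a = T v p * star (T v p) * star ?a * T v p * star (T v p)" .
  have "?b = T v p' * star (T v p') * ?b * (T v p' * star (T v p'))" by (rule loc[OF assms(2)])
  with a have "star ?a * ?b = (T v p * star (T v p) * star ?a * T v p * star (T v p))
      * (T v p' * star (T v p') * ?b * (T v p' * star (T v p')))"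
    by metis
  also have "\<dots> = T v p * star (T v p) * star ?a * T v p * (star (T v p) * T v p')
      * (star (T v p') * ?b * (T v p' * star (T v p')))"
    by (simp only: mult.assoc)
  also have "\<dots> = 0" using assms by (simp add: star_T_T)
  finally show ?thesis .
qed

end

section \<open>Products of shifted unitaries\<close>

locale shift_product = graph_cstar_state E P S \<Phi> \<tau> \<beta> \<xi>
  for E :: "('v, 'e) pre_digraph" and P :: "'v \<Rightarrow> 'a::cstar_algebra" and S :: "'e \<Rightarrow> 'a"
    and \<Phi> \<tau> \<beta> \<xi> +
  fixes q :: 'a
  assumes vcomm: "vertex_comm q" and unitary: "unitary q"
    and core1: "q \<in> core_level E P S 1" and not_diag: "q \<notin> diag_level E P S 1"
begin

section \<open>The matrix of \<open>q\<close>\<close>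

abbreviation Q :: "nat \<Rightarrow> 'a"
  where "Q \<equiv> shift_prod E S q"

text \<open>This is the matrix coefficient of \<open>q\<close>. If the heads of \<open>e\<close> and
  \<open>f\<close> differ, the defining equation reads \<open>0 = 0\<close> and the chosen scalar
  carries no information.\<close>

definition entry :: "'e \<Rightarrow> 'e \<Rightarrow> complex"
  where "entry e f = (SOME c. star (S e) * q * S f = c *\<^sub>C (P (head E e) * P (head E f)))"

lemma entry: "e \<in> arcs E \<Longrightarrow> f \<in> arcs E \<Longrightarrow>
    star (S e) * q * S f = entry e f *\<^sub>C (P (head E e) * P (head E f))"
  unfolding entry_def by (rule someI_ex) (rule core_level_1_compress[OF core1])

lemma Q_vcomm: "v \<in> verts E \<Longrightarrow> P v * Q n = Q n * P v"
  by (intro vertex_commD vertex_comm_shift_prod vcomm)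

text \<open>By the recursion \<open>Q (Suc n)\<close> is \<open>q * \<phi> (Q n)\<close>, and
  \<open>S f\<close> can be moved through \<open>\<phi> (Q n)\<close>, leaving the compression of
  \<open>q\<close>.\<close>

lemma compress_Q:
  assumes "e \<in> arcs E" "f \<in> arcs E"
  shows "star (S e) * Q (Suc n) * S f = entry e f *\<^sub>C (P (head E e) * P (head E f) * Q n)"
proof -
  have "star (S e) * Q (Suc n) * S f = star (S e) * q * S f * Q n"
    using assms vertex_comm_shift_prod[OF vcomm, of n]
    by (simp add: shift_prod_Suc[OF vcomm] mult.assoc shift_vertex_comm_S)
  then show ?thesis using assms by (simp add: entry mult_scaleC_left)
qed

text \<open>This is \<open>q * star q = 1\<close>, compressed by \<open>S e\<close> and with the sum
  of all range projections inserted in the middle. The index \<open>f\<close> is restricted to edges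
  with the same head as \<open>e\<close>, where \<open>entry\<close> is meaningful.\<close>

lemma row_norm:
  assumes e: "e \<in> arcs E"
  shows "(\<Sum>f | f \<in> arcs E \<and> head E f = head E e. (cmod (entry e f))\<^sup>2) = 1"
proof -
  have h: "head E e \<in> verts E" using e by simp
  have "P (head E e) = star (S e) * (q * 1 * star q) * S e"
    using e unitary by (simp add: unitary_def S_star_S_self)
  also have "\<dots> = (\<Sum>f\<in>arcs E. star (S e) * q * S f * star (star (S e) * q * S f))"
    unfolding sum_S_S_star[symmetric]
    by (simp add: sum_distrib_left sum_distrib_right star_mult star_star mult.assoc)
  also have "\<dots> = (\<Sum>f\<in>arcs E. if head E f = head E e
      then complex_of_real ((cmod (entry e f))\<^sup>2) *\<^sub>C P (head E e) else 0)"
  proof (intro sum.cong refl)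
    fix f assume f: "f \<in> arcs E"
    have "cnj (entry e f) * entry e f = complex_of_real ((cmod (entry e f))\<^sup>2)"
      by (simp only: complex_norm_square mult.commute)
    then show "star (S e) * q * S f * star (star (S e) * q * S f) = (if head E f = head E e
      then complex_of_real ((cmod (entry e f))\<^sup>2) *\<^sub>C P (head E e) else 0)"
      using e f h by (auto simp: entry P_mult star_scaleC P_star mult_scaleC_left mult_scaleC_right
        scaleC_scaleC scaleC_simps)
  qed
  also have "\<dots> = (\<Sum>f | f \<in> arcs E \<and> head E f = head E e.
      complex_of_real ((cmod (entry e f))\<^sup>2) *\<^sub>C P (head E e))"
    by (subst sum.inter_filter[symmetric]) auto
  also have "\<dots> = complex_of_real (\<Sum>f | f \<in> arcs E \<and> head E f = head E e. (cmod (entry e f))\<^sup>2)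
      *\<^sub>C P (head E e)"
    by (simp only: of_real_sum complex_vector.scale_sum_left)
  finally have "complex_of_real (\<Sum>f | f \<in> arcs E \<and> head E f = head E e. (cmod (entry e f))\<^sup>2)
      *\<^sub>C P (head E e) = 1 *\<^sub>C P (head E e)"
    by (simp only: complex_vector.scale_one)
  then have "complex_of_real (\<Sum>f | f \<in> arcs E \<and> head E f = head E e. (cmod (entry e f))\<^sup>2) = 1"
    using P_nonzero[OF h] by (simp only: complex_vector.scale_cancel_right simp_thms)
  then show ?thesis by (simp only: of_real_eq_1_iff)
qed

definition weight :: "'e \<Rightarrow> real"
  where "weight e = (cmod (entry e e))\<^sup>2"

lemma weight_nonneg: "0 \<le> weight e"
  by (simp add: weight_def)

lemma weight_le_1:
  assumes "e \<in> arcs E"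
  shows "weight e \<le> 1"
  unfolding row_norm[OF assms, symmetric] weight_def
  by (rule member_le_sum) (use assms in auto)

text \<open>If all diagonal entries had modulus 1, the row norms would leave nothing for the other
  entries, and \<open>q\<close> would be a combination of the projections
  \<open>S e * star (S e)\<close>, contrary to \<open>not_diag\<close>.\<close>

lemma ex_weight_less_1: "\<exists>e\<in>arcs E. weight e < 1"
proof (rule ccontr)
  assume "\<not> ?thesis"
  then have one: "weight e = 1" if "e \<in> arcs E" for e
    using weight_le_1[OF that] that by force
  have off: "star (S e) * q * S f = 0" if "e \<in> arcs E" "f \<in> arcs E" "e \<noteq> f" for e f
  proof (cases "head E e = head E f")
    case True
    let ?A = "{g. g \<in> arcs E \<and> head E g = head E e}"
    have "(\<Sum>g\<in>?A. (cmod (entry e g))\<^sup>2) = weight e + (\<Sum>g\<in>?A - {e}. (cmod (entry e g))\<^sup>2)"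
      unfolding weight_def by (rule sum.remove) (use that in auto)
    then have "(\<Sum>g\<in>?A - {e}. (cmod (entry e g))\<^sup>2) = 0"
      using row_norm[OF that(1)] one[OF that(1)] by simp
    then have "(cmod (entry e f))\<^sup>2 = 0"
      using that True by (subst (asm) sum_nonneg_eq_0_iff) auto
    then show ?thesis using that by (simp add: entry scaleC_simps)
  next
    case False
    then show ?thesis using that by (simp add: entry P_mult scaleC_simps)
  qed
  have "q = 1 * q * 1" by simp
  also have "\<dots> = (\<Sum>e\<in>arcs E. \<Sum>f\<in>arcs E. S e * (star (S e) * q * S f) * star (S f))"
    unfolding sum_S_S_star[symmetric]
    by (simp add: sum_distrib_left sum_distrib_right mult.assoc) (rule sum.swap)
  also have "\<dots> = (\<Sum>e\<in>arcs E. \<Sum>f\<in>arcs E.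
      if e = f then S e * (star (S e) * q * S e) * star (S e) else 0)"
    by (intro sum.cong refl) (auto simp: off)
  also have "\<dots> = (\<Sum>e\<in>arcs E. S e * (star (S e) * q * S e) * star (S e))" by simp
  also have "\<dots> = (\<Sum>e\<in>arcs E. entry e e *\<^sub>C (S e * star (S e)))"
    by (intro sum.cong refl)
      (simp add: entry P_mult S_P mult_scaleC_left mult_scaleC_right)
  also have "\<dots> \<in> diag_level E P S 1"
    unfolding diag_level_1
    by (intro complex_vector.span_sum complex_vector.span_scale complex_vector.span_base) auto
  finally show False using not_diag by simp
qed

section \<open>The expectation of \<open>Q\<close> between path elements\<close>

text \<open>Expanding the range projections on both sides of \<open>Q\<close> trades one factor of
  \<open>Q\<close> for one more edge on each path. Both computations of \<open>\<Phi>\<close> below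
  are inductions along this expansion.\<close>

lemma T_Q_star_T_Suc:
  assumes "awalk v p w" "awalk v' p' w'"
  shows "T v p * Q (Suc n) * star (T v' p') = (\<Sum>e\<in>out_arcs E w. \<Sum>f\<in>out_arcs E w'.
    entry e f *\<^sub>C (T v (p @ [e]) * Q n * star (T v' (p' @ [f]))))"
proof -
  have w: "w \<in> verts E" "w' \<in> verts E" using assms by auto
  have "T v p * Q (Suc n) * star (T v' p') = T v p * P w * Q (Suc n) * (P w' * star (T v' p'))"
    using assms w by (simp add: T_P P_star_T)
  also have "\<dots> = (\<Sum>e\<in>out_arcs E w. \<Sum>f\<in>out_arcs E w'.
      T v p * S e * (star (S e) * Q (Suc n) * S f) * (star (S f) * star (T v' p')))"
    unfolding P_eq_sum[OF w(1)] P_eq_sum[OF w(2)]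
    by (simp add: sum_distrib_left sum_distrib_right mult.assoc) (rule sum.swap)
  also have "\<dots> = (\<Sum>e\<in>out_arcs E w. \<Sum>f\<in>out_arcs E w'.
      entry e f *\<^sub>C (T v (p @ [e]) * Q n * star (T v' (p' @ [f]))))"
  proof (intro sum.cong refl)
    fix e f assume ef: "e \<in> out_arcs E w" "f \<in> out_arcs E w'"
    have e: "awalk v (p @ [e]) (head E e)" and f: "awalk v' (p' @ [f]) (head E f)"
      using ef assms by (auto intro!: awalk_snoc simp del: awalk_append_iff)
    have "S e * (P (head E e) * P (head E f) * Q n) * star (S f)
        = S e * Q n * (P (head E f) * star (S f))"
      using ef Q_vcomm[of "head E f" n] by (simp add: mult.assoc S_P_mult)
    also have "\<dots> = S e * Q n * star (S f)" using ef by (simp add: P_star_S)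
    finally have inner: "S e * (P (head E e) * P (head E f) * Q n) * star (S f) = S e * Q n * star (S f)" .
    have "T v p * S e * (star (S e) * Q (Suc n) * S f) * (star (S f) * star (T v' p'))
        = entry e f *\<^sub>C (T v p * (S e * (P (head E e) * P (head E f) * Q n) * star (S f)) * star (T v' p'))"
      using ef by (simp add: compress_Q mult_scaleC_left mult_scaleC_right) (simp add: mult.assoc)
    also have "\<dots> = entry e f *\<^sub>C (T v (p @ [e]) * Q n * star (T v' (p' @ [f])))"
      unfolding inner T_snoc[OF e] T_snoc[OF f] star_mult by (simp add: mult.assoc)
    finally show "T v p * S e * (star (S e) * Q (Suc n) * S f) * (star (S f) * star (T v' p'))
        = entry e f *\<^sub>C (T v (p @ [e]) * Q n * star (T v' (p' @ [f])))" .
  qed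
  finally show ?thesis .
qed

text \<open>Distinct paths stay distinct when each is extended by one edge, so the induction ends at
  the vanishing of \<open>\<Phi>\<close> on products for distinct paths. The lengths need not
  agree.\<close>

lemma cond_exp_off_diagonal:
  assumes "awalk v p w" "awalk v' p' w'" "(v, p) \<noteq> (v', p')"
  shows "\<Phi> (T v p * Q n * star (T v' p')) = 0"
  using assms
proof (induction n arbitrary: p p' w w')
  case 0
  then have "(v, p) \<in> (\<Union>k. paths E k)" "(v', p') \<in> (\<Union>k. paths E k)"
    by (auto simp: mem_paths_iff simp del: UN_iff intro!: UN_I)
  then show ?case using 0 cond_exp_off_diag by simp
next
  case (Suc n)
  have "\<Phi> (T v (p @ [e]) * Q n * star (T v' (p' @ [f]))) = 0"
    if "e \<in> out_arcs E w" "f \<in> out_arcs E w'" for e f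
    using Suc.IH[OF awalk_snoc[OF Suc.prems(1) that(1)] awalk_snoc[OF Suc.prems(2) that(2)]]
      Suc.prems(3) by auto
  then show ?case
    unfolding T_Q_star_T_Suc[OF Suc.prems(1,2)]
    by (simp add: cond_exp.sum cond_exp.scale scaleC_simps)
qed

text \<open>After applying \<open>\<Phi>\<close> only the terms with \<open>e = f\<close> of the
  expansion survive; they are orthogonal, so their squared norms add up with factors
  \<open>weight e\<close>. The base case is the trace of a path projection.\<close>

lemma sqnorm_diagonal:
  assumes "awalk v p w"
  shows "sqnorm (\<Phi> (T v p * Q n * star (T v p)))
    = weighted_walks E weight \<beta> \<xi> n w / ((\<Sum>v\<in>verts E. \<xi> v) * \<beta> ^ length p)"
  using assms
proof (induction n arbitrary: p w)
  case 0
  have "star (T v p * star (T v p)) * (T v p * star (T v p)) = T v p * star (T v p)"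
    using T_partial_isometry[OF 0] by (simp add: star_mult star_star mult.assoc[symmetric])
  then show ?case
    using trace_T[OF 0] cond_exp_fix[OF diag_T[OF 0]] by (simp add: sqnorm_def)
next
  case (Suc n)
  let ?X = "\<Sum>v\<in>verts E. \<xi> v"
  define a where "a e = entry e e *\<^sub>C \<Phi> (T v (p @ [e]) * Q n * star (T v (p @ [e])))" for e
  have aw: "awalk v (p @ [e]) (head E e)" if "e \<in> out_arcs E w" for e
    by (rule awalk_snoc[OF Suc.prems that])
  have "\<Phi> (T v p * Q (Suc n) * star (T v p)) = (\<Sum>e\<in>out_arcs E w. \<Sum>f\<in>out_arcs E w.
      entry e f *\<^sub>C \<Phi> (T v (p @ [e]) * Q n * star (T v (p @ [f]))))"
    unfolding T_Q_star_T_Suc[OF Suc.prems Suc.prems] by (simp add: cond_exp.sum cond_exp.scale)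
  also have "\<dots> = (\<Sum>e\<in>out_arcs E w. \<Sum>f\<in>out_arcs E w. if e = f then a e else 0)"
  proof (intro sum.cong refl)
    fix e f assume "e \<in> out_arcs E w" "f \<in> out_arcs E w"
    then show "entry e f *\<^sub>C \<Phi> (T v (p @ [e]) * Q n * star (T v (p @ [f]))) = (if e = f then a e else 0)"
      using cond_exp_off_diagonal[OF aw[of e] aw[of f], of n] by (auto simp: a_def scaleC_simps)
  qed
  also have "\<dots> = (\<Sum>e\<in>out_arcs E w. a e)" by (simp add: finite_out_arcs)
  finally have "sqnorm (\<Phi> (T v p * Q (Suc n) * star (T v p))) = sqnorm (\<Sum>e\<in>out_arcs E w. a e)"
    by simp
  also have "\<dots> = (\<Sum>e\<in>out_arcs E w. sqnorm (a e))"
  proof (rule sqnorm_orthogonal_sum)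
    show "a e \<in> diag E P S" for e unfolding a_def by (intro diag_scaleC cond_exp_diag)
    fix e f assume ef: "e \<in> out_arcs E w" "f \<in> out_arcs E w" "e \<noteq> f"
    have "star (\<Phi> (T v (p @ [e]) * Q n * star (T v (p @ [e]))))
        * \<Phi> (T v (p @ [f]) * Q n * star (T v (p @ [f]))) = 0"
      by (rule cond_exp_local[OF aw[OF ef(1)] aw[OF ef(2)]]) (use ef in auto)
    then show "star (a e) * a f = 0"
      by (simp add: a_def star_scaleC mult_scaleC_left mult_scaleC_right scaleC_simps)
  qed (rule finite_out_arcs)
  also have "\<dots> = (\<Sum>e\<in>out_arcs E w. weight e *
      (weighted_walks E weight \<beta> \<xi> n (head E e) / (?X * \<beta> ^ Suc (length p))))"
    using Suc.IH[OF aw] by (intro sum.cong refl) (simp add: a_def sqnorm_scaleC cond_exp_diag weight_def[symmetric])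
  \<comment> \<open>The additional factor \<open>\<beta>\<close> from the longer path is the divisor
    in the recursion of \<open>weighted_walks\<close>.\<close>
  also have "\<dots> = weighted_walks E weight \<beta> \<xi> (Suc n) w / (?X * \<beta> ^ length p)"
    by (simp add: sum_divide_distrib mult.commute mult.left_commute)
  finally show ?case .
qed

lemma vanishing_T_Q_star_T:
  assumes "awalk v p w" "awalk v' p' w'"
  shows "vanishing (\<lambda>n. T v p * Q n * star (T v' p'))"
proof (cases "(v, p) = (v', p')")
  case True
  obtain e where e: "e \<in> arcs E" "weight e < 1" using ex_weight_less_1 by blast
  have w: "w \<in> verts E" using assms by auto
  have "(\<lambda>n. weighted_walks E weight \<beta> \<xi> n w) \<longlonglongrightarrow> 0"
    by (rule weighted_walks_tendsto_0[where ?e0.0 = e])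
      (use transitive \<beta>_pos \<xi>_pos eigenvector e w weight_nonneg weight_le_1 in auto)
  then have "(\<lambda>n. sqnorm (\<Phi> (T v p * Q n * star (T v p)))) \<longlonglongrightarrow> 0"
    unfolding sqnorm_diagonal[OF assms(1)] by (rule tendsto_divide_zero)
  then show ?thesis using True unfolding vanishing_def by simp
next
  case False
  then show ?thesis
    unfolding vanishing_def using cond_exp_off_diagonal[OF assms]
    by (simp add: sqnorm_def trace_0)
qed

section \<open>Reduction of arbitrary \<open>x\<close> and \<open>y\<close> to path elements\<close>

text \<open>Each pair of edges strips one factor off \<open>Q\<close> and contributes one matrix
  entry. The resulting scalar is the same for all \<open>n\<close>, so it does not disturb the
  limit.\<close>

lemma compress_Q_walk:
  assumes "awalk v p w" "awalk v' p' w'" "length p = length p'"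
  shows "\<exists>c. \<forall>n. star (T v p) * Q (n + length p) * T v' p' = c *\<^sub>C (P w * P w' * Q n)"
  using assms(3,1,2)
proof (induction p p' arbitrary: v v' rule: list_induct2)
  case Nil
  then have "v = w" "v' = w'" "w \<in> verts E" "w' \<in> verts E" by (auto simp: awalk_Nil_iff)
  then show ?case
    using Q_vcomm[of w', symmetric] by (intro exI[of _ 1]) (simp add: P_star mult.assoc scaleC_simps)
next
  case (Cons e p f p')
  have e: "e \<in> arcs E" "v = tail E e" "awalk (head E e) p w"
    and f: "f \<in> arcs E" "v' = tail E f" "awalk (head E f) p' w'"
    using Cons.prems by (auto simp: awalk_Cons_iff)
  obtain c where c: "\<And>n. star (T (head E e) p) * Q (n + length p) * T (head E f) p'
      = c *\<^sub>C (P w * P w' * Q n)"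
    using Cons.IH[OF e(3) f(3)] by blast
  have "star (T v (e # p)) * Q (n + length (e # p)) * T v' (f # p')
      = (entry e f * c) *\<^sub>C (P w * P w' * Q n)" for n
  proof -
    have "star (T v (e # p)) * Q (n + length (e # p)) * T v' (f # p')
        = star (T (head E e) p) * (star (S e) * Q (Suc (n + length p)) * S f) * T (head E f) p'"
      using Cons.prems by (simp add: T_Cons star_mult mult.assoc)
    also have "\<dots> = entry e f *\<^sub>C (star (T (head E e) p) * P (head E e)
        * (P (head E f) * Q (n + length p)) * T (head E f) p')"
      unfolding compress_Q[OF e(1) f(1)]
      by (simp only: mult_scaleC_left mult_scaleC_right mult.assoc)
    also have "\<dots> = entry e f *\<^sub>C (star (T (head E e) p) * Q (n + length p)
        * (P (head E f) * T (head E f) p'))"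
      using e f by (simp add: star_T_P Q_vcomm mult.assoc)
    also have "\<dots> = (entry e f * c) *\<^sub>C (P w * P w' * Q n)"
      using f by (simp add: P_T c scaleC_scaleC)
    finally show ?thesis .
  qed
  then show ?case by blast
qed

lemma vanishing_span:
  assumes "x \<in> cspan A" and "\<And>a. a \<in> A \<Longrightarrow> vanishing (\<lambda>n. a * Q n * y)"
  shows "vanishing (\<lambda>n. x * Q n * y)"
  using assms(1)
proof (induction rule: complex_vector.span_induct)
  case base
  show ?case
    by (rule complex_vector.subspaceI)
      (auto simp: distrib_right mult_scaleC_left vanishing_zero vanishing_add vanishing_scaleC)
qed (rule assms(2))

text \<open>Taking the adjoint of the right factor puts the second path of a word next to
  \<open>Q\<close> on this side too. Scalars become conjugated, which is harmless for a subspace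
  argument.\<close>

lemma vanishing_span_star:
  assumes "y \<in> cspan A" and "\<And>a. a \<in> A \<Longrightarrow> vanishing (\<lambda>n. x * Q n * star a)"
  shows "vanishing (\<lambda>n. x * Q n * star y)"
  using assms(1)
proof (induction rule: complex_vector.span_induct)
  case base
  show ?case
    by (rule complex_vector.subspaceI)
      (auto simp: distrib_left mult_scaleC_right star_add star_scaleC
        vanishing_zero vanishing_add vanishing_scaleC)
qed (rule assms(2))

text \<open>The two inner paths have length \<open>k\<close> and compress \<open>Q (n + k)\<close>
  to a scalar multiple of \<open>Q n\<close> between vertex projections. What remains lies between
  the outer path elements, or vanishes if ranges do not match.\<close>

lemma vanishing_level_words:
  assumes "x \<in> level_words k" "y \<in> level_words k"
  shows "vanishing (\<lambda>n. x * Q n * star y)"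
proof -
  obtain v p w v' p' w' where x: "x = T v p * star (T v' p')" "awalk v p w" "awalk v' p' w'"
    and k: "length p' = k" using assms(1) unfolding level_words_def by blast
  obtain a b c a' b' c' where y: "y = T a b * star (T a' b')" "awalk a b c" "awalk a' b' c'"
    and k': "length b' = k" using assms(2) unfolding level_words_def by blast
  obtain z where z: "\<And>n. star (T v' p') * Q (n + k) * T a' b' = z *\<^sub>C (P w' * P c' * Q n)"
    using compress_Q_walk[OF x(3) y(3)] k k' by auto
  have verts: "w' \<in> verts E" "c' \<in> verts E" using x y by auto
  have "x * Q (n + k) * star y
      = (if w' = w \<and> c' = c then z else 0) *\<^sub>C (T v p * Q n * star (T a b))" for n
  proof -
    have "x * Q (n + k) * star y = T v p * (star (T v' p') * Q (n + k) * T a' b') * star (T a b)"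
      by (simp add: x y star_mult star_star mult.assoc)
    also have "\<dots> = z *\<^sub>C (T v p * P w' * Q n * (P c' * star (T a b)))"
      unfolding z using verts Q_vcomm[of c' n]
      by (simp add: mult_scaleC_left mult_scaleC_right mult.assoc)
    finally show ?thesis
      using x y verts by (auto simp: T_P P_star_T scaleC_simps)
  qed
  then have "vanishing (\<lambda>n. x * Q (n + k) * star y)"
    using vanishing_scaleC[OF vanishing_T_Q_star_T[OF x(2) y(2)]] by simp
  then show ?thesis by (rule vanishing_offset[of "\<lambda>n. x * Q n * star y"])
qed

lemma vanishing_words:
  assumes "x \<in> words" "y \<in> words"
  shows "vanishing (\<lambda>n. x * Q n * star y)"
proof -
  obtain v p w v' p' w' where x: "x = T v p * star (T v' p')" "awalk v p w" "awalk v' p' w'"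
    using assms(1) unfolding words_def by blast
  obtain a b c a' b' c' where y: "y = T a b * star (T a' b')" "awalk a b c" "awalk a' b' c'"
    using assms(2) unfolding words_def by blast
  \<comment> \<open>Both inner paths are lengthened to a common length, as compression
    requires.\<close>
  define k where "k = max (length p') (length b')"
  have "x \<in> cspan (level_words k)" "y \<in> cspan (level_words k)"
    using span_level_words[OF x(2,3), of "k - length p'"] span_level_words[OF y(2,3), of "k - length b'"]
    by (auto simp: x(1) y(1) k_def)
  then show ?thesis
    by (blast intro: vanishing_span vanishing_span_star vanishing_level_words)
qed

lemma norm_Q: "norm (Q n) = 1"
  by (intro norm_unitary unitary_shift_prod vcomm unitary)

text \<open>Density is used twice: first \<open>x\<close> is approximated with \<open>y\<close>
  still in the span, then \<open>y\<close>. Since every \<open>Q n\<close> has norm 1, the errors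
  are uniform in \<open>n\<close>.\<close>

lemma vanishing_Q: "vanishing (\<lambda>n. x * Q n * y)"
proof -
  have approx: "\<exists>x'\<in>cspan words. norm (x - x') \<le> \<epsilon>" if "\<epsilon> > 0" for x and \<epsilon> :: real
    using words_dense[of x] that
    by (metis closure_approachable dist_commute dist_norm less_imp_le)
  have left: "vanishing (\<lambda>n. x * Q n * star y)" if y: "y \<in> cspan words" for x y
  proof (rule vanishing_approx)
    fix \<epsilon> :: real assume "\<epsilon> > 0"
    \<comment> \<open>The summand 1 avoids division by zero when \<open>y\<close> is 0.\<close>
    then have "\<epsilon> / (norm y + 1) > 0" by (simp add: add_nonneg_pos)
    then obtain x' where x': "x' \<in> cspan words" "norm (x - x') \<le> \<epsilon> / (norm y + 1)"
      using approx by blast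
    have "norm (x * Q n * star y - x' * Q n * star y) \<le> \<epsilon>" for n
    proof -
      have "x * Q n * star y - x' * Q n * star y = (x - x') * Q n * star y"
        by (simp add: left_diff_distrib)
      then have "norm (x * Q n * star y - x' * Q n * star y) \<le> norm (x - x') * norm (Q n) * norm (star y)"
        by (simp only: norm_mult_mult_le)
      also have "\<dots> \<le> \<epsilon> / (norm y + 1) * (norm y + 1)"
        unfolding norm_Q mult_1_right norm_star
        by (intro mult_mono) (use x' \<open>\<epsilon> > 0\<close> in auto)
      also have "\<dots> = \<epsilon>" using norm_ge_zero[of y] by (simp add: add_nonneg_eq_0_iff)
      finally show ?thesis .
    qed
    moreover have "vanishing (\<lambda>n. x' * Q n * star y)"
      using x'(1) y by (blast intro: vanishing_span vanishing_span_star vanishing_words)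
    ultimately show "\<exists>Y. vanishing Y \<and> (\<forall>n. norm (x * Q n * star y - Y n) \<le> \<epsilon>)" by blast
  qed
  show ?thesis
  proof (rule vanishing_approx)
    fix \<epsilon> :: real assume "\<epsilon> > 0"
    then have "\<epsilon> / (norm x + 1) > 0" by (simp add: add_nonneg_pos)
    then obtain y' where y': "y' \<in> cspan words" "norm (star y - y') \<le> \<epsilon> / (norm x + 1)"
      using approx by blast
    have "star (star y - y') = y - star y'" by (simp add: star_diff star_star)
    then have ny: "norm (y - star y') \<le> \<epsilon> / (norm x + 1)" using y'(2) by (metis norm_star)
    have "norm (x * Q n * y - x * Q n * star y') \<le> \<epsilon>" for n
    proof -
      have "x * Q n * y - x * Q n * star y' = x * Q n * (y - star y')"
        by (simp add: right_diff_distrib)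
      then have "norm (x * Q n * y - x * Q n * star y') \<le> norm x * norm (Q n) * norm (y - star y')"
        by (simp only: norm_mult_mult_le)
      also have "\<dots> \<le> (norm x + 1) * (\<epsilon> / (norm x + 1))"
        unfolding norm_Q mult_1_right by (intro mult_mono) (use ny \<open>\<epsilon> > 0\<close> in auto)
      also have "\<dots> = \<epsilon>" using norm_ge_zero[of x] by (simp add: add_nonneg_eq_0_iff)
      finally show ?thesis .
    qed
    then show "\<exists>Y. vanishing Y \<and> (\<forall>n. norm (x * Q n * y - Y n) \<le> \<epsilon>)" using left[OF y'(1)] by blast
  qed
qed

end

section \<open>The automorphism and inner conjugacy\<close>

context graph_cstar
begin

section \<open>The image of diagonal products under the automorphism\<close>

lemma frakB_vertex_comm: "u \<in> frakB E P S \<Longrightarrow> vertex_comm u"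
proof -
  assume u: "u \<in> frakB E P S"
  have "P v \<in> diag_level E P S 0" if "v \<in> verts E" for v
    using diag_level_base[of v "[]" v] that by (simp add: awalk_Nil_iff P_star P_idem)
  then show ?thesis using u by (auto simp: frakB_def vertex_comm_def)
qed

lemma frakB_core_level: "u \<in> frakB E P S \<Longrightarrow> u \<in> core_level E P S 1"
  by (simp add: frakB_def)

text \<open>Applying \<open>\<Lambda>\<close> after \<open>\<phi>\<close> gives
  \<open>\<phi>\<close> after \<open>\<Lambda>\<close>, conjugated by \<open>u\<close>. In the
  recursion the right-hand \<open>u\<close> of \<open>conj_by u d\<close> cancels against this
  conjugation, up to one \<open>u\<close> that has to pass through a shifted element.\<close>

lemma automorphism_shift_prod:
  assumes \<Lambda>: "\<Lambda> \<in> star_hom cstar_UNIV cstar_UNIV"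
    and \<Lambda>S: "\<And>e. e \<in> arcs E \<Longrightarrow> \<Lambda> (S e) = u * S e" and \<Lambda>P: "\<And>v. v \<in> verts E \<Longrightarrow> \<Lambda> (P v) = P v"
    and u: "u \<in> frakB E P S" "unitary u" and d: "d \<in> diag_level E P S 1"
  shows "\<Lambda> (shift_prod E S d n) = shift_prod E S (conj_by u d) n"
proof -
  have add: "\<Lambda> (a + b) = \<Lambda> a + \<Lambda> b" and mult: "\<Lambda> (a * b) = \<Lambda> a * \<Lambda> b"
    and scale: "\<Lambda> (c *\<^sub>C a) = c *\<^sub>C \<Lambda> a" and star: "\<Lambda> (star a) = star (\<Lambda> a)" for a b c
    using \<Lambda> by (simp_all add: star_hom_def)
  have zero: "\<Lambda> 0 = 0" using scale[of 0 0] by (simp add: scaleC_simps)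
  have sum: "\<Lambda> (sum f A) = (\<Sum>x\<in>A. \<Lambda> (f x))" for f :: "'x \<Rightarrow> 'a" and A
    by (induction A rule: infinite_finite_induct) (auto simp: zero add)
  \<comment> \<open>Preservation of the unit is not part of \<open>star_hom\<close>; it follows
    because 1 is the sum of the fixed vertex projections.\<close>
  have one: "\<Lambda> 1 = 1"
    using \<Lambda>P by (simp flip: sum_P add: sum)
  have shift: "\<Lambda> (\<phi> a) = u * \<phi> (\<Lambda> a) * star u" for a
    by (simp add: shift_def sum mult star \<Lambda>S star_mult sum_distrib_left sum_distrib_right mult.assoc)
  have \<Lambda>d: "\<Lambda> d = conj_by u d"
    using d unfolding diag_level_1
  proof (induction rule: complex_vector.span_induct)
    case base
    show ?case
      by (rule complex_vector.subspaceI) (auto simp: conj_by_def zero add scale distrib_left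
        distrib_right mult_scaleC_left mult_scaleC_right)
  next
    case (step x)
    then show ?case by (auto simp: conj_by_def mult star \<Lambda>S star_mult mult.assoc)
  qed
  have vd: "vertex_comm d" by (rule diag_level_1_vertex_comm[OF d])
  have vu: "vertex_comm u" by (rule frakB_vertex_comm[OF u(1)])
  have vq: "vertex_comm (conj_by u d)"
    unfolding conj_by_def by (intro vertex_comm_mult vertex_comm_star vu vd)
  show ?thesis
  proof (induction n)
    case 0
    show ?case by (simp add: one)
  next
    case (Suc n)
    have "\<Lambda> (shift_prod E S d (Suc n))
        = conj_by u d * (u * \<phi> (shift_prod E S (conj_by u d) n)) * star u"
      by (simp add: shift_prod_Suc[OF vd] mult shift \<Lambda>d Suc mult.assoc)
    \<comment> \<open>\<open>u\<close> belongs to the first core level and hence commutes with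
      shifted elements; after the exchange it meets its adjoint and cancels.\<close>
    also have "u * \<phi> (shift_prod E S (conj_by u d) n) = \<phi> (shift_prod E S (conj_by u d) n) * u"
      by (intro core_level_1_shift_comm frakB_core_level u vertex_comm_shift_prod vq)
    finally show ?case
      using u(2) by (simp add: shift_prod_Suc[OF vq] unitary_def mult.assoc)
  qed
qed

end

theorem theorem3p3:
  fixes E :: "('v, 'e) pre_digraph"
    and P :: "'v \<Rightarrow> 'a::cstar_algebra" and S :: "'e \<Rightarrow> 'a"
    and \<Phi> :: "'a \<Rightarrow> 'a" and \<tau> :: "'a \<Rightarrow> complex" and \<beta> :: real and \<xi> :: "'v \<Rightarrow> real"
    and u d :: 'a and \<Lambda> :: "'a \<Rightarrow> 'a"
  assumes "fin_digraph E" and "transitive_graph E" and "every_cycle_has_exit E"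
    and "graph_cstar_algebra E P S"
    and "faithful_conditional_expectation \<Phi> (diag E P S)"
    and "\<And>\<mu> \<nu>. \<mu> \<in> (\<Union>k. paths E k) \<Longrightarrow> \<nu> \<in> (\<Union>k. paths E k) \<Longrightarrow> \<mu> \<noteq> \<nu> \<Longrightarrow>
           \<Phi> (path_elem P S \<mu> * star (path_elem P S \<nu>)) = 0"
    and "\<beta> > 0" and "perron_frobenius_eigenvalue E \<beta>"
    and "\<And>v. v \<in> verts E \<Longrightarrow> \<xi> v > 0" and "adjacency_eigenvector E \<beta> \<xi>"
    and "tracial_state_on (core E P S) \<tau>"
    and "\<And>k \<mu> \<nu>. \<mu> \<in> paths E k \<Longrightarrow> \<nu> \<in> paths E k \<Longrightarrow> path_range E \<mu> = path_range E \<nu> \<Longrightarrow>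
           \<tau> (path_elem P S \<mu> * star (path_elem P S \<nu>)) =
             (if \<mu> = \<nu> then of_real (\<xi> (path_range E \<mu>) / ((\<Sum>v\<in>verts E. \<xi> v) * \<beta> ^ k)) else 0)"
    and "u \<in> frakB E P S" and "unitary u"
    and "conj_by u ` diag_level E P S 1 \<noteq> diag_level E P S 1"
    and "d \<in> diag_level E P S 1" and "unitary d"
    and "conj_by u d \<notin> diag_level E P S 1"
    and "star_automorphism \<Lambda>"
    and "\<And>e. e \<in> arcs E \<Longrightarrow> \<Lambda> (S e) = u * S e"
    and "\<And>v. v \<in> verts E \<Longrightarrow> \<Lambda> (P v) = P v"
  shows "(\<forall>x y. (\<lambda>k. norm2 \<tau> (\<Phi> (x * shift_prod E S (conj_by u d) k * y))) \<longlonglongrightarrow> 0) \<and>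
         \<not> (\<exists>w. unitary w \<and> conj_by w ` diag E P S = \<Lambda> ` diag E P S)"
proof -
  interpret fin_digraph E by fact
  interpret graph_cstar E P S by unfold_locales fact+
  have q: "vertex_comm (conj_by u d)" "unitary (conj_by u d)" "conj_by u d \<in> core_level E P S 1"
  proof -
    note u = frakB_vertex_comm[OF assms(13)] frakB_core_level[OF assms(13)]
    show "vertex_comm (conj_by u d)"
      unfolding conj_by_def
      by (intro vertex_comm_mult vertex_comm_star u diag_level_1_vertex_comm assms(16))
    show "unitary (conj_by u d)"
      unfolding conj_by_def by (intro unitary_mult unitary_star assms)
    show "conj_by u d \<in> core_level E P S 1"
      unfolding conj_by_def
      using u(2) assms(16) diag_level_subset_core_level[of 1]
      by (intro core_level_1_mult core_level_1_star) auto
  qed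
  interpret shift_product E P S \<Phi> \<tau> \<beta> \<xi> "conj_by u d"
    by unfold_locales (fact assms q)+
  have lim: "(\<lambda>k. norm2 \<tau> (\<Phi> (x * Q k * y))) \<longlonglongrightarrow> 0" for x y
    using tendsto_real_sqrt[OF vanishing_Q[of x y, unfolded vanishing_def]]
    by (simp add: norm2_def sqnorm_def)
  moreover have False if w: "unitary w" and eq: "conj_by w ` diag E P S = \<Lambda> ` diag E P S" for w
  proof -
    have "norm2 \<tau> (\<Phi> (star w * Q k * w)) = 1" for k
    proof -
      have "shift_prod E S d k \<in> diag E P S"
        using shift_prod_diag_level[OF assms(16)] diag_level_subset_diag by blast
      then have "\<Lambda> (shift_prod E S d k) \<in> conj_by w ` diag E P S" using eq by blast
      moreover have "\<Lambda> (shift_prod E S d k) = Q k"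
        by (rule automorphism_shift_prod) (use assms in \<open>auto simp: star_automorphism_def\<close>)
      ultimately obtain a where a: "a \<in> diag E P S" "Q k = conj_by w a" by auto
      \<comment> \<open>Undoing the conjugation by \<open>w\<close> leads back to the diagonal
        element \<open>a\<close>, on which \<open>\<Phi>\<close> acts as the identity.\<close>
      have "star w * Q k * w = (star w * w) * a * (star w * w)"
        unfolding a(2) conj_by_def[of w] by (simp only: mult.assoc)
      then have "star w * Q k * w \<in> diag E P S" using w a by (simp add: unitary_def)
      then have "\<Phi> (star w * Q k * w) = star w * Q k * w" by (rule cond_exp_fix)
      moreover have "unitary (star w * Q k * w)"
        by (intro unitary_mult unitary_star w unitary_shift_prod q)
      ultimately show ?thesis by (simp add: norm2_def unitary_def trace_one)
    qed
    \<comment> \<open>The limit statement is applied with \<open>star w\<close> on the left and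
      \<open>w\<close> on the right.\<close>
    then have "(\<lambda>k. 1 :: real) \<longlonglongrightarrow> 0" using lim[of "star w" w] by simp
    then show False by (simp add: LIMSEQ_const_iff)
  qed
  ultimately show ?thesis by blast
qed

end
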